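(* Let $H$ be a Hopf algebra over a field $\Bbbk$. If $H$ is virtually pointed, then for any left $H$-modules $V$ and $W$, $$(V \otimes W)_{\mathrm{fin}} = V_{\mathrm{fin}} \otimes W_{\mathrm{fin}}$$ (as subspaces of $V \otimes W$).
   Context: $\Bbbk$ is an arbitrary field and $\otimes = \otimes_\Bbbk$. For a left $H$-module $V$, the locally finite part is $V_{\mathrm{fin}} = \{ v \in V \mid \dim_\Bbbk H.v < \infty\}$, i.e. the sum of all finite-dimensional submodules of $V$. The tensor product $V \otimes W$ of left $H$-modules is an $H$-module via $h.(v \otimes w) = h_{(1)}.v \otimes h_{(2)}.w$, where $\Delta h = h_{(1)} \otimes h_{(2)}$ is the comultiplication. $H$ is called virtually pointed if $H$ is finitely generated as a right module over some pointed Hopf subalgebra $K \subseteq H$; a Hopf algebra is pointed if all its simple subcoalgebras are one-dimensional. *)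

theory Defs
  imports Complex_Main "HOL-Library.Function_Algebras"
begin

section \<open>Tensor products of vector spaces\<close>

text \<open>
  A vector space is a type \<open>'v :: ab_group_add\<close> with a scalar multiplication satisfying the
  locale \<^locale>\<open>vector_space\<close>. The tensor product of \<open>'v\<close> and \<open>'w\<close> is realised inside the space
  of functions from bilinear forms to scalars: the pure tensor of \<open>v\<close> and \<open>w\<close> is evaluation at
  \<open>(v, w)\<close>. The theorems \<open>bilinear_pure_tensor\<close>, \<open>tensor_lift_pure\<close>, \<open>tensor_lift_add\<close>,
  \<open>tensor_lift_scale\<close> and \<open>tensor_lift_unique\<close> below establish the universal property, for
  arbitrary vector spaces as targets.
\<close>

type_synonym ('k, 'v, 'w) tensor = "('v \<Rightarrow> 'w \<Rightarrow> 'k) \<Rightarrow> 'k"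

definition bilinear_map ::
  "('k::field \<Rightarrow> 'v::ab_group_add \<Rightarrow> 'v) \<Rightarrow> ('k \<Rightarrow> 'w::ab_group_add \<Rightarrow> 'w) \<Rightarrow>
   ('k \<Rightarrow> 'u::ab_group_add \<Rightarrow> 'u) \<Rightarrow> ('v \<Rightarrow> 'w \<Rightarrow> 'u) \<Rightarrow> bool" where
  "bilinear_map sV sW sU f \<longleftrightarrow>
     (\<forall>w. Vector_Spaces.linear sV sU (\<lambda>v. f v w)) \<and>
     (\<forall>v. Vector_Spaces.linear sW sU (\<lambda>w. f v w))"

definition fun_scale :: "'k::field \<Rightarrow> ('a \<Rightarrow> 'k) \<Rightarrow> ('a \<Rightarrow> 'k)" where
  "fun_scale c t = (\<lambda>b. c * t b)"

definition pure_tensor ::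
  "('k::field \<Rightarrow> 'v::ab_group_add \<Rightarrow> 'v) \<Rightarrow> ('k \<Rightarrow> 'w::ab_group_add \<Rightarrow> 'w) \<Rightarrow>
   'v \<Rightarrow> 'w \<Rightarrow> ('k, 'v, 'w) tensor" where
  "pure_tensor sV sW v w = (\<lambda>b. if bilinear_map sV sW (*) b then b v w else 0)"

text \<open>For subspaces \<open>A\<close>, \<open>B\<close>, the image of the (injective) map from the tensor product of
  \<open>A\<close> and \<open>B\<close> to the full tensor product.\<close>

definition tensor_subspace ::
  "('k::field \<Rightarrow> 'v::ab_group_add \<Rightarrow> 'v) \<Rightarrow> ('k \<Rightarrow> 'w::ab_group_add \<Rightarrow> 'w) \<Rightarrow>
   'v set \<Rightarrow> 'w set \<Rightarrow> ('k, 'v, 'w) tensor set" where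
  "tensor_subspace sV sW A B =
     module.span fun_scale {pure_tensor sV sW a b | a b. a \<in> A \<and> b \<in> B}"

abbreviation tensor_space ::
  "('k::field \<Rightarrow> 'v::ab_group_add \<Rightarrow> 'v) \<Rightarrow> ('k \<Rightarrow> 'w::ab_group_add \<Rightarrow> 'w) \<Rightarrow>
   ('k, 'v, 'w) tensor set" where
  "tensor_space sV sW \<equiv> tensor_subspace sV sW UNIV UNIV"

text \<open>The linear map on the tensor product induced by a bilinear map \<open>f\<close>, sending
  \<open>v\<^sub>1 \<otimes> w\<^sub>1 + \<dots> + v\<^sub>n \<otimes> w\<^sub>n\<close> to \<open>f v\<^sub>1 w\<^sub>1 + \<dots> + f v\<^sub>n w\<^sub>n\<close>.\<close>

definition tensor_lift ::
  "('k::field \<Rightarrow> 'v::ab_group_add \<Rightarrow> 'v) \<Rightarrow> ('k \<Rightarrow> 'w::ab_group_add \<Rightarrow> 'w) \<Rightarrow>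
   ('v \<Rightarrow> 'w \<Rightarrow> 'u::ab_group_add) \<Rightarrow> ('k, 'v, 'w) tensor \<Rightarrow> 'u" where
  "tensor_lift sV sW f t =
     (THE u. \<exists>xs. t = (\<Sum>(v, w)\<leftarrow>xs. pure_tensor sV sW v w) \<and> u = (\<Sum>(v, w)\<leftarrow>xs. f v w))"

text \<open>Threefold tensors, by the same construction with trilinear forms.\<close>

definition trilinear_form ::
  "('k::field \<Rightarrow> 'u::ab_group_add \<Rightarrow> 'u) \<Rightarrow> ('k \<Rightarrow> 'v::ab_group_add \<Rightarrow> 'v) \<Rightarrow>
   ('k \<Rightarrow> 'w::ab_group_add \<Rightarrow> 'w) \<Rightarrow> ('u \<Rightarrow> 'v \<Rightarrow> 'w \<Rightarrow> 'k) \<Rightarrow> bool" where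
  "trilinear_form sU sV sW f \<longleftrightarrow>
     (\<forall>v w. Vector_Spaces.linear sU (*) (\<lambda>u. f u v w)) \<and>
     (\<forall>u w. Vector_Spaces.linear sV (*) (\<lambda>v. f u v w)) \<and>
     (\<forall>u v. Vector_Spaces.linear sW (*) (\<lambda>w. f u v w))"

definition pure_tensor3 ::
  "('k::field \<Rightarrow> 'u::ab_group_add \<Rightarrow> 'u) \<Rightarrow> ('k \<Rightarrow> 'v::ab_group_add \<Rightarrow> 'v) \<Rightarrow>
   ('k \<Rightarrow> 'w::ab_group_add \<Rightarrow> 'w) \<Rightarrow> 'u \<Rightarrow> 'v \<Rightarrow> 'w \<Rightarrow> ('u \<Rightarrow> 'v \<Rightarrow> 'w \<Rightarrow> 'k) \<Rightarrow> 'k" where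
  "pure_tensor3 sU sV sW u v w = (\<lambda>f. if trilinear_form sU sV sW f then f u v w else 0)"

lemma vector_space_fun_scale: "vector_space (fun_scale :: 'k::field \<Rightarrow> ('a \<Rightarrow> 'k) \<Rightarrow> 'a \<Rightarrow> 'k)"
  by unfold_locales (auto simp: fun_scale_def algebra_simps)

lemma vector_space_mult: "vector_space ((*) :: 'k::field \<Rightarrow> 'k \<Rightarrow> 'k)"
  by unfold_locales (auto simp: algebra_simps)

lemma linear_map_iff:
  "Vector_Spaces.linear s1 s2 f \<longleftrightarrow> vector_space s1 \<and> vector_space s2 \<and>
    (\<forall>x y. f (x + y) = f x + f y) \<and> (\<forall>c x. f (s1 c x) = s2 c (f x))"
  by (auto simp: Vector_Spaces.linear_def module_hom_def module_hom_axioms_def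
      vector_space_def module_def)

lemma linear_map_zero: "Vector_Spaces.linear s1 s2 f \<Longrightarrow> f 0 = 0"
  by (metis linear_map_iff add_cancel_right_right)

lemma bilinear_pure_tensor:
  assumes "vector_space sV" "vector_space sW"
  shows "bilinear_map sV sW fun_scale (pure_tensor sV sW)"
  using assms
  by (auto simp: bilinear_map_def linear_map_iff pure_tensor_def fun_scale_def vector_space_fun_scale
      plus_fun_def fun_eq_iff)

lemma linear_functionals_separate:
  assumes "vector_space s" "\<And>\<phi>. Vector_Spaces.linear s (*) \<phi> \<Longrightarrow> \<phi> u = \<phi> v"
  shows "u = v"
proof (rule ccontr)
  assume "u \<noteq> v"
  interpret vector_space_pair s "(*)"
    using assms(1) vector_space_mult by (simp add: vector_space_pair_def)
  have "vs1.independent {u - v}"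
    using \<open>u \<noteq> v\<close> by (simp add: vs1.dependent_single)
  then obtain \<phi> where \<phi>: "Vector_Spaces.linear s (*) \<phi>" "\<phi> (u - v) = 1"
    using linear_independent_extend[of "{u - v}" "\<lambda>_. 1"] by auto
  moreover have "\<phi> (u - v) + \<phi> v = \<phi> u"
    using \<phi>(1) unfolding linear_map_iff by (metis diff_add_cancel)
  ultimately show False
    using assms(2)[OF \<phi>(1)] by simp
qed

lemma tensor_lift_wd:
  assumes f: "bilinear_map sV sW sU f"
    and eq: "(\<Sum>(v, w)\<leftarrow>xs. pure_tensor sV sW v w) = (\<Sum>(v, w)\<leftarrow>ys. pure_tensor sV sW v w)"
  shows "(\<Sum>(v, w)\<leftarrow>xs. f v w) = (\<Sum>(v, w)\<leftarrow>ys. f v w)"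
proof (rule linear_functionals_separate)
  show "vector_space sU"
    using f by (simp add: bilinear_map_def linear_map_iff)
next
  fix \<phi> assume \<phi>: "Vector_Spaces.linear sU (*) \<phi>"
  let ?b = "\<lambda>v w. \<phi> (f v w)"
  have b: "bilinear_map sV sW (*) ?b"
    using f \<phi> by (auto simp: bilinear_map_def linear_map_iff)
  have ev: "(\<Sum>(v, w)\<leftarrow>zs. pure_tensor sV sW v w) ?b = \<phi> (\<Sum>(v, w)\<leftarrow>zs. f v w)" for zs
    by (induction zs) (use \<phi> b in \<open>auto simp: linear_map_zero linear_map_iff pure_tensor_def\<close>)
  show "\<phi> (\<Sum>(v, w)\<leftarrow>xs. f v w) = \<phi> (\<Sum>(v, w)\<leftarrow>ys. f v w)"
    using ev[of xs] ev[of ys] eq by simp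
qed

lemma tensor_lift_sum_list:
  assumes "bilinear_map sV sW sU f"
  shows "tensor_lift sV sW f (\<Sum>(v, w)\<leftarrow>xs. pure_tensor sV sW v w) = (\<Sum>(v, w)\<leftarrow>xs. f v w)"
  unfolding tensor_lift_def
proof (rule the_equality)
  fix u
  assume "\<exists>ys. (\<Sum>(v, w)\<leftarrow>xs. pure_tensor sV sW v w) = (\<Sum>(v, w)\<leftarrow>ys. pure_tensor sV sW v w) \<and>
    u = (\<Sum>(v, w)\<leftarrow>ys. f v w)"
  then show "u = (\<Sum>(v, w)\<leftarrow>xs. f v w)"
    using tensor_lift_wd[OF assms, of xs] by (elim exE conjE) simp
qed (rule exI[of _ xs], simp)

theorem tensor_lift_pure:
  "bilinear_map sV sW sU f \<Longrightarrow> tensor_lift sV sW f (pure_tensor sV sW v w) = f v w"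
  using tensor_lift_sum_list[where xs = "[(v, w)]"] by simp

lemma sum_list_scale_left:
  assumes "bilinear_map sV sW sU f"
  shows "sU c (\<Sum>(v, w)\<leftarrow>xs. f v w) = (\<Sum>(v, w)\<leftarrow>map (\<lambda>(v, w). (sV c v, w)) xs. f v w)"
proof -
  interpret vector_space sU
    using assms by (simp add: bilinear_map_def linear_map_iff)
  show ?thesis
    using assms by (induction xs) (auto simp: bilinear_map_def linear_map_iff scale_right_distrib)
qed

lemma tensor_space_iff:
  fixes sV :: "'k::field \<Rightarrow> 'v::ab_group_add \<Rightarrow> 'v" and sW :: "'k \<Rightarrow> 'w::ab_group_add \<Rightarrow> 'w"
  assumes "vector_space sV" "vector_space sW"
  shows "t \<in> tensor_space sV sW \<longleftrightarrow> (\<exists>xs. t = (\<Sum>(v, w)\<leftarrow>xs. pure_tensor sV sW v w))"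
proof -
  interpret F: vector_space "fun_scale :: 'k \<Rightarrow> ('k, 'v, 'w) tensor \<Rightarrow> _"
    by (rule vector_space_fun_scale)
  let ?T = "{t. \<exists>xs. t = (\<Sum>(v, w)\<leftarrow>xs. pure_tensor sV sW v w)}"
  have "F.subspace ?T"
  proof (rule F.subspaceI)
    show "0 \<in> ?T"
      by (auto intro: exI[of _ "[]"])
    show "x + y \<in> ?T" if "x \<in> ?T" "y \<in> ?T" for x y
      using that by (auto simp flip: sum_list_append map_append)
    show "fun_scale c x \<in> ?T" if "x \<in> ?T" for c x
    proof -
      from that obtain xs where x: "x = (\<Sum>(v, w)\<leftarrow>xs. pure_tensor sV sW v w)"
        by blast
      show ?thesis
        unfolding x sum_list_scale_left[OF bilinear_pure_tensor[OF assms]] by blast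
    qed
  qed
  moreover have "{pure_tensor sV sW a b | a b. a \<in> UNIV \<and> b \<in> UNIV} \<subseteq> ?T"
    by (auto intro: exI[of _ "[(_, _)]"])
  ultimately have "tensor_space sV sW \<subseteq> ?T"
    unfolding tensor_subspace_def by (intro F.span_minimal)
  moreover have "(\<Sum>(v, w)\<leftarrow>xs. pure_tensor sV sW v w) \<in> tensor_space sV sW" for xs
    unfolding tensor_subspace_def
  proof (induction xs)
    case Nil
    show ?case
      by (simp only: list.map sum_list.Nil F.span_zero)
  next
    case (Cons x xs)
    have "pure_tensor sV sW (fst x) (snd x) \<in>
        F.span {pure_tensor sV sW a b | a b. a \<in> UNIV \<and> b \<in> UNIV}"
      by (intro F.span_base) blast
    from F.span_add[OF this Cons] show ?case
      by (simp only: list.map sum_list.Cons case_prod_unfold)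
  qed
  ultimately show ?thesis
    by blast
qed

theorem tensor_lift_add:
  assumes "bilinear_map sV sW sU f" "t \<in> tensor_space sV sW" "t' \<in> tensor_space sV sW"
  shows "tensor_lift sV sW f (t + t') = tensor_lift sV sW f t + tensor_lift sV sW f t'"
proof -
  have vs: "vector_space sV" "vector_space sW"
    using assms(1) by (auto simp: bilinear_map_def linear_map_iff)
  obtain xs ys where t: "t = (\<Sum>(v, w)\<leftarrow>xs. pure_tensor sV sW v w)"
      and t': "t' = (\<Sum>(v, w)\<leftarrow>ys. pure_tensor sV sW v w)"
    using assms(2,3) unfolding tensor_space_iff[OF vs] by blast
  have "t + t' = (\<Sum>(v, w)\<leftarrow>xs @ ys. pure_tensor sV sW v w)"
    by (simp add: t t')
  then have "tensor_lift sV sW f (t + t') = (\<Sum>(v, w)\<leftarrow>xs @ ys. f v w)"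
    by (simp only: tensor_lift_sum_list[OF assms(1)])
  then show ?thesis
    by (simp add: t t' tensor_lift_sum_list[OF assms(1)])
qed

theorem tensor_lift_scale:
  assumes "bilinear_map sV sW sU f" "t \<in> tensor_space sV sW"
  shows "tensor_lift sV sW f (fun_scale c t) = sU c (tensor_lift sV sW f t)"
proof -
  have vs: "vector_space sV" "vector_space sW"
    using assms(1) by (auto simp: bilinear_map_def linear_map_iff)
  obtain xs where t: "t = (\<Sum>(v, w)\<leftarrow>xs. pure_tensor sV sW v w)"
    using assms(2) unfolding tensor_space_iff[OF vs] by blast
  show ?thesis
    unfolding t sum_list_scale_left[OF bilinear_pure_tensor[OF vs]]
      tensor_lift_sum_list[OF assms(1)] sum_list_scale_left[OF assms(1)] ..
qed

theorem tensor_lift_unique: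
  assumes "bilinear_map sV sW sU f" "t \<in> tensor_space sV sW"
    and "\<And>v w. g (pure_tensor sV sW v w) = f v w"
    and "\<And>t t'. t \<in> tensor_space sV sW \<Longrightarrow> t' \<in> tensor_space sV sW \<Longrightarrow> g (t + t') = g t + g t'"
  shows "g t = tensor_lift sV sW f t"
proof -
  have vs: "vector_space sV" "vector_space sW"
    using assms(1) by (auto simp: bilinear_map_def linear_map_iff)
  obtain xs where t: "t = (\<Sum>(v, w)\<leftarrow>xs. pure_tensor sV sW v w)"
    using assms(2) unfolding tensor_space_iff[OF vs] by blast
  have mem: "(\<Sum>(v, w)\<leftarrow>ys. pure_tensor sV sW v w) \<in> tensor_space sV sW" for ys
    using tensor_space_iff[OF vs] by blast
  have mem1: "pure_tensor sV sW v w \<in> tensor_space sV sW" for v w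
    using mem[of "[(v, w)]"] by simp
  have "g 0 = 0"
    using assms(4)[OF mem[of "[]"] mem[of "[]"]] by simp
  then have "g (\<Sum>(v, w)\<leftarrow>ys. pure_tensor sV sW v w) = (\<Sum>(v, w)\<leftarrow>ys. f v w)" for ys
    by (induction ys) (auto simp: assms(3) assms(4)[OF mem1 mem])
  then show ?thesis
    by (simp add: t tensor_lift_sum_list[OF assms(1)])
qed

text \<open>Threefold tensors are faithful: a relation between them is preserved by every trilinear map.\<close>

theorem pure_tensor3_universal:
  assumes f: "\<And>v w. Vector_Spaces.linear sU sX (\<lambda>u. f u v w)"
      "\<And>u w. Vector_Spaces.linear sV sX (\<lambda>v. f u v w)"
      "\<And>u v. Vector_Spaces.linear sW sX (\<lambda>w. f u v w)"
    and eq: "(\<Sum>(u, v, w)\<leftarrow>xs. pure_tensor3 sU sV sW u v w) =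
      (\<Sum>(u, v, w)\<leftarrow>ys. pure_tensor3 sU sV sW u v w)"
  shows "(\<Sum>(u, v, w)\<leftarrow>xs. f u v w) = (\<Sum>(u, v, w)\<leftarrow>ys. f u v w)"
proof (rule linear_functionals_separate)
  show "vector_space sX"
    using f(1) by (simp add: linear_map_iff)
next
  fix \<phi> assume \<phi>: "Vector_Spaces.linear sX (*) \<phi>"
  let ?b = "\<lambda>u v w. \<phi> (f u v w)"
  have b: "trilinear_form sU sV sW ?b"
    using f \<phi> by (auto simp: trilinear_form_def linear_map_iff)
  have ev: "(\<Sum>(u, v, w)\<leftarrow>zs. pure_tensor3 sU sV sW u v w) ?b = \<phi> (\<Sum>(u, v, w)\<leftarrow>zs. f u v w)"
    for zs
    by (induction zs) (use \<phi> b in \<open>auto simp: linear_map_zero linear_map_iff pure_tensor3_def\<close>)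
  show "\<phi> (\<Sum>(u, v, w)\<leftarrow>xs. f u v w) = \<phi> (\<Sum>(u, v, w)\<leftarrow>ys. f u v w)"
    using ev[of xs] ev[of ys] eq by simp
qed


section \<open>Hopf algebras\<close>

locale unital_algebra = vector_space scale
  for scale :: "'k::field \<Rightarrow> 'h::ring_1 \<Rightarrow> 'h" +
  assumes mult_scale_left: "scale c a * b = scale c (a * b)"
    and mult_scale_right: "a * scale c b = scale c (a * b)"

text \<open>
  Coassociativity and counit laws are in Sweedler form: if \<open>\<Delta> h = \<Sum> a \<otimes> b\<close>, then
  \<^term>\<open>tensor_lift scale scale f (\<Delta> h)\<close> is \<open>\<Sum> f a b\<close>.
\<close>

locale coalgebra = vector_space scale
  for scale :: "'k::field \<Rightarrow> 'h::ab_group_add \<Rightarrow> 'h" +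
  fixes \<Delta> :: "'h \<Rightarrow> ('k, 'h, 'h) tensor"
    and \<epsilon> :: "'h \<Rightarrow> 'k"
  assumes comult_closed: "\<Delta> h \<in> tensor_space scale scale"
    and linear_comult: "Vector_Spaces.linear scale fun_scale \<Delta>"
    and linear_counit: "Vector_Spaces.linear scale (*) \<epsilon>"
    and coassoc:
      "tensor_lift scale scale
         (\<lambda>a b. tensor_lift scale scale (\<lambda>x y. pure_tensor3 scale scale scale x y b) (\<Delta> a)) (\<Delta> h) =
       tensor_lift scale scale
         (\<lambda>a b. tensor_lift scale scale (\<lambda>x y. pure_tensor3 scale scale scale a x y) (\<Delta> b)) (\<Delta> h)"
    and counit_left: "tensor_lift scale scale (\<lambda>a b. scale (\<epsilon> a) b) (\<Delta> h) = h"
    and counit_right: "tensor_lift scale scale (\<lambda>a b. scale (\<epsilon> b) a) (\<Delta> h) = h"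
begin

definition subcoalgebra :: "'h set \<Rightarrow> bool" where
  "subcoalgebra D \<longleftrightarrow> subspace D \<and> (\<forall>d\<in>D. \<Delta> d \<in> tensor_subspace scale scale D D)"

definition simple_subcoalgebra :: "'h set \<Rightarrow> bool" where
  "simple_subcoalgebra D \<longleftrightarrow> subcoalgebra D \<and> D \<noteq> {0} \<and>
     (\<forall>E. subcoalgebra E \<and> E \<subseteq> D \<longrightarrow> E = {0} \<or> E = D)"

text \<open>Pointedness of a subcoalgebra \<open>K\<close> as a coalgebra in its own right; the subcoalgebras of
  \<open>K\<close> are the subcoalgebras of the ambient coalgebra that are contained in \<open>K\<close>.\<close>

definition pointed :: "'h set \<Rightarrow> bool" where
  "pointed K \<longleftrightarrow> (\<forall>D. simple_subcoalgebra D \<and> D \<subseteq> K \<longrightarrow> dim D = 1)"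

end

definition tensor_mult ::
  "('k::field \<Rightarrow> 'h::ring_1 \<Rightarrow> 'h) \<Rightarrow> ('k, 'h, 'h) tensor \<Rightarrow> ('k, 'h, 'h) tensor \<Rightarrow>
   ('k, 'h, 'h) tensor" where
  "tensor_mult s t t' =
     tensor_lift s s (\<lambda>a b. tensor_lift s s (\<lambda>c d. pure_tensor s s (a * c) (b * d)) t') t"

locale hopf_algebra = unital_algebra scale + coalgebra scale \<Delta> \<epsilon>
  for scale :: "'k::field \<Rightarrow> 'h::ring_1 \<Rightarrow> 'h"
    and \<Delta> :: "'h \<Rightarrow> ('k, 'h, 'h) tensor"
    and \<epsilon> :: "'h \<Rightarrow> 'k" +
  fixes S :: "'h \<Rightarrow> 'h"
  assumes comult_one: "\<Delta> 1 = pure_tensor scale scale 1 1"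
    and comult_mult: "\<Delta> (a * b) = tensor_mult scale (\<Delta> a) (\<Delta> b)"
    and counit_one: "\<epsilon> 1 = 1"
    and counit_mult: "\<epsilon> (a * b) = \<epsilon> a * \<epsilon> b"
    and linear_antipode: "Vector_Spaces.linear scale scale S"
    and antipode_left: "tensor_lift scale scale (\<lambda>a b. S a * b) (\<Delta> h) = scale (\<epsilon> h) 1"
    and antipode_right: "tensor_lift scale scale (\<lambda>a b. a * S b) (\<Delta> h) = scale (\<epsilon> h) 1"
begin

definition hopf_subalgebra :: "'h set \<Rightarrow> bool" where
  "hopf_subalgebra K \<longleftrightarrow> subcoalgebra K \<and> 1 \<in> K \<and> (\<forall>a\<in>K. \<forall>b\<in>K. a * b \<in> K) \<and> (\<forall>a\<in>K. S a \<in> K)"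

definition fin_gen_right_module_over :: "'h set \<Rightarrow> bool" where
  "fin_gen_right_module_over K \<longleftrightarrow>
     (\<exists>F. finite F \<and> (\<forall>h. \<exists>k. (\<forall>x\<in>F. k x \<in> K) \<and> h = (\<Sum>x\<in>F. x * k x)))"

definition virtually_pointed :: bool where
  "virtually_pointed \<longleftrightarrow>
     (\<exists>K. hopf_subalgebra K \<and> pointed K \<and> fin_gen_right_module_over K)"

end


section \<open>Modules and locally finite parts\<close>

locale left_module = unital_algebra scale + V: vector_space sV
  for scale :: "'k::field \<Rightarrow> 'h::ring_1 \<Rightarrow> 'h"
    and sV :: "'k \<Rightarrow> 'v::ab_group_add \<Rightarrow> 'v" +
  fixes act :: "'h \<Rightarrow> 'v \<Rightarrow> 'v"
  assumes bilinear_act: "bilinear_map scale sV sV act"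
    and act_one: "act 1 v = v"
    and act_mult: "act (a * b) v = act a (act b v)"

definition finite_dimensional :: "('k::field \<Rightarrow> 'v::ab_group_add \<Rightarrow> 'v) \<Rightarrow> 'v set \<Rightarrow> bool" where
  "finite_dimensional s X \<longleftrightarrow> (\<exists>B. finite B \<and> module.span s B = X)"

text \<open>The carrier \<open>X\<close> is explicit because a tensor product is a proper subspace of its type.\<close>

definition locally_finite_part ::
  "('k::field \<Rightarrow> 'v::ab_group_add \<Rightarrow> 'v) \<Rightarrow> 'v set \<Rightarrow> ('h \<Rightarrow> 'v \<Rightarrow> 'v) \<Rightarrow> 'v set" where
  "locally_finite_part s X act = {v \<in> X. finite_dimensional s (range (\<lambda>h. act h v))}"

definition tensor_act ::
  "('k::field \<Rightarrow> 'h::ab_group_add \<Rightarrow> 'h) \<Rightarrow> ('h \<Rightarrow> ('k, 'h, 'h) tensor) \<Rightarrow>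
   ('k \<Rightarrow> 'v::ab_group_add \<Rightarrow> 'v) \<Rightarrow> ('h \<Rightarrow> 'v \<Rightarrow> 'v) \<Rightarrow>
   ('k \<Rightarrow> 'w::ab_group_add \<Rightarrow> 'w) \<Rightarrow> ('h \<Rightarrow> 'w \<Rightarrow> 'w) \<Rightarrow>
   'h \<Rightarrow> ('k, 'v, 'w) tensor \<Rightarrow> ('k, 'v, 'w) tensor" where
  "tensor_act s \<Delta> sV actV sW actW h t =
     tensor_lift s s
       (\<lambda>a b. tensor_lift sV sW (\<lambda>v w. pure_tensor sV sW (actV a v) (actW b w)) t) (\<Delta> h)"

end

theory Submission
  imports Defs
begin

text \<open>
  If \<open>H.t\<close> is finite-dimensional, then so are the smallest subspaces \<open>V'\<close> and \<open>W'\<close> with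
  \<open>H.t \<subseteq> V' \<otimes> W\<close> and \<open>H.t \<subseteq> V \<otimes> W'\<close>, and \<open>t \<in> V' \<otimes> W'\<close>. The antipode shows that \<open>W'\<close>
  is an \<open>H\<close>-submodule. For \<open>V'\<close> let \<open>K\<close> be a pointed Hopf subalgebra over which \<open>H\<close> is finitely
  generated. Finite-dimensional right coideals of \<open>K\<close> have flags of right coideals with
  \<open>\<Delta> n \<in> n \<otimes> g + E \<otimes> K\<close> for some grouplike \<open>g\<close>, where \<open>E\<close> is the preceding term. Since \<open>g\<close> is
  invertible, it follows inductively along the flag that \<open>n\<close> preserves \<open>V'\<close>: modulo terms in
  \<open>E.V' \<otimes> W\<close>, the element \<open>n\<close> acts on \<open>H.t\<close> as \<open>n \<otimes> g\<close>. So \<open>V'\<close> is \<open>K\<close>-stable, and \<open>H.V'\<close> is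
  finite-dimensional.
\<close>

section \<open>Linear algebra\<close>

text \<open>The two supports behave differently. Letting \<open>h\<close> act on the right leg alone
  only takes \<open>S h1 * h2\<close>; letting it act on the left leg alone would take a
  compositional inverse of the antipode, which a Hopf algebra may lack. Pointedness is the
  substitute: along a flag only grouplikes have to be inverted, and \<open>S g\<close> does that.

  Tensors have no canonical legs, so membership in a subspace such as \<open>E \<otimes> H\<close>
  is tested by slicing with functionals. Slicing turns the comultiplication into two commuting
  actions of the dual algebra on \<open>H\<close>, and right coideals and subcoalgebras become
  subspaces stable under one or both of them. The flag itself comes from the one-dimensionality of
  simple comodules over a pointed coalgebra, which is proved directly from coefficient spaces,
  without quotient spaces and without finite-dimensional dual algebras.

  The side of the finite generation matters: in \<open>h = \<Sum> x * k\<close> the factor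
  \<open>k\<close> acts first and stays inside \<open>V'\<close>, after which only finitely many
  \<open>x\<close> remain to be applied.\<close>

abbreviation linear_functional :: "('k::field \<Rightarrow> 'v::ab_group_add \<Rightarrow> 'v) \<Rightarrow> ('v \<Rightarrow> 'k) \<Rightarrow> bool" where
  "linear_functional s \<equiv> Vector_Spaces.linear s (*)"

context vector_space
begin

section \<open>Bases and dimensions inside a finite-dimensional span\<close>

lemma finite_basis_of_subspace:
  assumes "subspace X" "X \<subseteq> span B" "finite B"
  obtains C where "finite C" "independent C" "C \<subseteq> X" "span C = X" "card C = dim X"
proof -
  obtain C where C: "C \<subseteq> X" "independent C" "X \<subseteq> span C" "card C = dim X"
    using basis_exists by blast
  moreover have "finite C"
    using independent_span_bound[OF assms(3) C(2)] C(1) assms(2) by blast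
  moreover have "span C = X"
    by (rule span_subspace) (use C assms(1) in auto)
  ultimately show ?thesis using that by blast
qed

lemma finite_basis_of_span:
  assumes "finite S"
  obtains F where "finite F" "independent F" "span F = span S" "F \<subseteq> span S"
  by (rule finite_basis_of_subspace[OF subspace_span order.refl assms])

lemma finite_dimensional_subspace:
  assumes "subspace X" "X \<subseteq> span B" "finite B"
  shows "finite_dimensional scale X"
  using finite_basis_of_subspace[OF assms] unfolding finite_dimensional_def by blast

lemma dim_le_card_spanning:
  assumes "subspace X" "X \<subseteq> span B" "finite B"
  shows "dim X \<le> card B"
proof -
  obtain C where C: "independent C" "C \<subseteq> X" "card C = dim X"
    by (rule finite_basis_of_subspace[OF assms])
  then have "C \<subseteq> span B"
    using assms(2) by (rule_tac subset_trans)
  from independent_span_bound[OF assms(3) C(1) this] show ?thesis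
    by (simp add: C(3))
qed

text \<open>The finite set \<open>B\<close> guards against infinite dimension: \<open>dim\<close> is
  the cardinality of a basis, so it is 0 for infinite-dimensional spaces and is not monotone
  there.\<close>

lemma dim_less_of_psubset:
  assumes "subspace X" "subspace Y" "X \<subset> Y" "Y \<subseteq> span B" "finite B"
  shows "dim X < dim Y"
proof -
  have "X \<subseteq> span B"
    using assms(3,4) by (meson psubset_imp_subset subset_trans)
  then obtain C where C: "finite C" "independent C" "span C = X" "card C = dim X"
    by (rule finite_basis_of_subspace[OF assms(1) _ assms(5)])
  obtain D where D: "finite D" "span D = Y" "card D = dim Y"
    by (rule finite_basis_of_subspace[OF assms(2,4,5)])
  obtain y where y: "y \<in> Y" "y \<notin> X"
    using assms(3) by (rule psubsetE) auto
  have ind: "independent (insert y C)"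
    using C y by (simp add: independent_insert)
  have CX: "C \<subseteq> X"
    using span_superset[of C] by (simp add: C(3))
  then have "insert y C \<subseteq> span D"
    using y assms(3) by (auto simp: D(2))
  then have "card (insert y C) \<le> card D"
    using independent_span_bound[OF D(1) ind] by simp
  moreover have "y \<notin> C"
    using y CX by auto
  ultimately show ?thesis
    using C D by simp
qed

end

text \<open>Quotient spaces are never formed: functionals that kill \<open>E\<close> stand in for
  the functionals on the quotient by \<open>E\<close>.\<close>

lemma functional_vanishing_on_subspace:
  assumes "vector_space s" "module.subspace s E" "n \<notin> E"
  obtains \<phi> where "linear_functional s \<phi>" "\<forall>e\<in>E. \<phi> e = 0" "\<phi> n = 1"
proof -
  interpret vector_space_pair s "(*)"
    using assms(1) vector_space_mult by (simp add: vector_space_pair_def)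
  obtain C where C: "C \<subseteq> E" "vs1.independent C" "E \<subseteq> vs1.span C"
    by (rule vs1.basis_exists[of E])
  have sp: "vs1.span C = E"
    by (rule vs1.span_subspace) (use C assms(2) in auto)
  have ind: "vs1.independent (insert n C)"
    using C assms(3) sp by (simp add: vs1.independent_insert)
  define f where "f x = (if x = n then 1 else 0 :: 'a)" for x
  obtain \<phi> where \<phi>: "linear_functional s \<phi>" "\<forall>x\<in>insert n C. \<phi> x = f x"
    using linear_independent_extend[OF ind] by metis
  have "n \<notin> C"
    using assms(3) C(1) by (rule contra_subsetD[rotated])
  then have "\<phi> x = 0" if "x \<in> C" for x
    using \<phi>(2) that by (metis f_def insertCI)
  then have "\<forall>e\<in>E. \<phi> e = 0"
    using linear_eq_0_on_span[OF \<phi>(1)] sp by metis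
  moreover have "\<phi> n = 1"
    using \<phi>(2) by (simp add: f_def)
  ultimately show ?thesis
    using that \<phi>(1) by metis
qed

lemma functional_dual_to_independent:
  assumes "vector_space s" "\<not> module.dependent s F" "b \<in> F"
  obtains \<phi> where "linear_functional s \<phi>" "\<forall>x\<in>F. \<phi> x = (if x = b then 1 else 0)"
proof -
  interpret vector_space s by fact
  have b: "b \<notin> span (F - {b})"
    using assms(2,3) dependent_def by blast
  obtain \<phi> where \<phi>: "linear_functional s \<phi>" "\<forall>e\<in>span (F - {b}). \<phi> e = 0" "\<phi> b = 1"
    by (rule functional_vanishing_on_subspace[OF assms(1) subspace_span b])
  have "\<forall>x\<in>F. \<phi> x = (if x = b then 1 else 0)"
    using \<phi>(2,3) span_base by auto
  with \<phi>(1) show ?thesis by (rule that)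
qed

lemma linear_map_simps:
  assumes "Vector_Spaces.linear s1 s2 f"
  shows "f 0 = 0" "f (x + y) = f x + f y" "f (s1 c x) = s2 c (f x)" "f (- x) = - f x"
    "f (x - y) = f x - f y" "f (\<Sum>i\<in>I. g i) = (\<Sum>i\<in>I. f (g i))"
proof -
  interpret Vector_Spaces.linear s1 s2 f by fact
  show "f 0 = 0" "f (x + y) = f x + f y" "f (s1 c x) = s2 c (f x)" "f (- x) = - f x"
    "f (x - y) = f x - f y" "f (\<Sum>i\<in>I. g i) = (\<Sum>i\<in>I. f (g i))"
    by (simp_all add: zero add scale neg diff sum)
qed

lemma linear_map_sum_list:
  assumes "Vector_Spaces.linear s1 s2 f"
  shows "f (\<Sum>x\<leftarrow>xs. g x) = (\<Sum>x\<leftarrow>xs. f (g x))"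
  by (induction xs) (simp_all add: linear_map_simps[OF assms])

lemma linear_functional_comp:
  assumes "Vector_Spaces.linear s1 s2 f" "Vector_Spaces.linear s2 s3 \<phi>"
  shows "Vector_Spaces.linear s1 s3 (\<lambda>x. \<phi> (f x))"
  using assms by (simp add: linear_map_iff)

lemma bilinear_mapD:
  assumes "bilinear_map sV sW sU f"
  shows "vector_space sV" "vector_space sW" "vector_space sU"
    "Vector_Spaces.linear sV sU (\<lambda>v. f v w)" "Vector_Spaces.linear sW sU (f v)"
  using assms by (auto simp: bilinear_map_def linear_map_iff)

section \<open>Contractions of tensors\<close>

lemma module_fun_scale: "module (fun_scale :: 'k::field \<Rightarrow> ('a \<Rightarrow> 'k) \<Rightarrow> 'a \<Rightarrow> 'k)"
  by (simp add: module_iff_vector_space vector_space_fun_scale)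

lemma pure_tensor_in:
  "a \<in> A \<Longrightarrow> b \<in> B \<Longrightarrow> pure_tensor sV sW a b \<in> tensor_subspace sV sW A B"
  unfolding tensor_subspace_def by (intro module.span_base[OF module_fun_scale]) blast

lemma subspace_tensor_subspace: "module.subspace fun_scale (tensor_subspace sV sW A B)"
  unfolding tensor_subspace_def
  by (rule module.subspace_span[OF module_fun_scale])

lemma tensor_subspace_mono:
  assumes "A \<subseteq> A'" "B \<subseteq> B'"
  shows "tensor_subspace sV sW A B \<subseteq> tensor_subspace sV sW A' B'"
  unfolding tensor_subspace_def using assms
  by (intro module.span_mono[OF module_fun_scale]) blast

lemma tensor_subspace_ops:
  shows "0 \<in> tensor_subspace sV sW A B"
    and "t \<in> tensor_subspace sV sW A B \<Longrightarrow> t' \<in> tensor_subspace sV sW A B \<Longrightarrow>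
      t + t' \<in> tensor_subspace sV sW A B"
    and "t \<in> tensor_subspace sV sW A B \<Longrightarrow> t' \<in> tensor_subspace sV sW A B \<Longrightarrow>
      t - t' \<in> tensor_subspace sV sW A B"
    and "t \<in> tensor_subspace sV sW A B \<Longrightarrow> fun_scale c t \<in> tensor_subspace sV sW A B"
  using subspace_tensor_subspace[of sV sW A B]
  by (blast intro: module.subspace_0[OF module_fun_scale] module.subspace_add[OF module_fun_scale]
      module.subspace_diff[OF module_fun_scale] module.subspace_scale[OF module_fun_scale])+

lemma tensor_lift_diff:
  assumes "bilinear_map sV sW sU f" "t \<in> tensor_space sV sW" "t' \<in> tensor_space sV sW"
  shows "tensor_lift sV sW f (t - t') = tensor_lift sV sW f t - tensor_lift sV sW f t'"
  using tensor_lift_add[OF assms(1) tensor_subspace_ops(3)[OF assms(2,3)] assms(3)]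
  by (simp add: algebra_simps)

lemma tensor_lift_zero:
  assumes "bilinear_map sV sW sU f"
  shows "tensor_lift sV sW f 0 = 0"
  using tensor_lift_sum_list[OF assms, of "[]"] by simp

lemma tensor_lift_in_subspace:
  assumes f: "bilinear_map sV sW sU f" and Z: "module.subspace sU Z"
    and t: "t \<in> tensor_subspace sV sW A B"
    and gen: "\<And>a b. a \<in> A \<Longrightarrow> b \<in> B \<Longrightarrow> f a b \<in> Z"
  shows "tensor_lift sV sW f t \<in> Z"
proof -
  interpret U: vector_space sU using f by (rule bilinear_mapD)
  let ?T = "{t \<in> tensor_space sV sW. tensor_lift sV sW f t \<in> Z}"
  have "module.subspace fun_scale ?T"
    using Z
    by (intro module.subspaceI[OF module_fun_scale])
      (simp_all add: tensor_subspace_ops tensor_lift_add[OF f] tensor_lift_scale[OF f] tensor_lift_zero[OF f]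
        U.subspace_add U.subspace_scale U.subspace_0)
  then have "tensor_subspace sV sW A B \<subseteq> ?T"
    unfolding tensor_subspace_def[of _ _ A]
    by (intro module.span_minimal[OF module_fun_scale])
      (auto simp: pure_tensor_in tensor_lift_pure[OF f] gen)
  with t show ?thesis by blast
qed

lemma tensor_lift_compose:
  assumes f: "bilinear_map sV sW sU f" and \<phi>: "Vector_Spaces.linear sU sX \<phi>"
    and t: "t \<in> tensor_space sV sW"
  shows "\<phi> (tensor_lift sV sW f t) = tensor_lift sV sW (\<lambda>v w. \<phi> (f v w)) t"
proof -
  obtain xs where xs: "t = (\<Sum>(v, w)\<leftarrow>xs. pure_tensor sV sW v w)"
    using t tensor_space_iff[OF bilinear_mapD(1,2)[OF f]] by blast
  have "bilinear_map sV sW sX (\<lambda>v w. \<phi> (f v w))"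
    using f \<phi> by (auto simp: bilinear_map_def linear_map_iff)
  then show ?thesis
    unfolding xs tensor_lift_sum_list[OF f]
    by (subst tensor_lift_sum_list) (simp_all add: linear_map_sum_list[OF \<phi>] case_prod_unfold)
qed

text \<open>The parameter will be a Sweedler component of an outer sum. Linearity in it makes the
  outer integrand bilinear, so that nested lifts are meaningful.\<close>

lemma linear_tensor_lift_parameter:
  assumes f: "\<And>b. bilinear_map sV sW sU (f b)"
    and lin: "\<And>v w. Vector_Spaces.linear sB sU (\<lambda>b. f b v w)"
    and t: "t \<in> tensor_space sV sW"
  shows "Vector_Spaces.linear sB sU (\<lambda>b. tensor_lift sV sW (f b) t)"
proof -
  obtain xs where xs: "t = (\<Sum>(v, w)\<leftarrow>xs. pure_tensor sV sW v w)"
    using t tensor_space_iff[OF bilinear_mapD(1,2)[OF f]] by blast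
  interpret U: vector_space sU using bilinear_mapD(3)[OF f] .
  have "vector_space sB"
    using lin by (simp add: linear_map_iff)
  moreover have "(\<Sum>(v, w)\<leftarrow>xs. f (x + y) v w) = (\<Sum>(v, w)\<leftarrow>xs. f x v w) + (\<Sum>(v, w)\<leftarrow>xs. f y v w)"
    for x y
    by (induction xs) (auto simp: linear_map_simps[OF lin] algebra_simps)
  moreover have "(\<Sum>(v, w)\<leftarrow>xs. f (sB c x) v w) = sU c (\<Sum>(v, w)\<leftarrow>xs. f x v w)" for c x
    by (induction xs) (auto simp: linear_map_simps[OF lin] U.scale_right_distrib)
  ultimately show ?thesis
    unfolding xs by (simp add: linear_map_iff tensor_lift_sum_list[OF f] U.vector_space_axioms)
qed

text \<open>The slice map \<open>id \<otimes> f\<close>. Below, \<open>contract_left\<close> is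
  \<open>f \<otimes> id\<close>.\<close>

definition contract_right ::
  "('k::field \<Rightarrow> 'v::ab_group_add \<Rightarrow> 'v) \<Rightarrow> ('k \<Rightarrow> 'w::ab_group_add \<Rightarrow> 'w) \<Rightarrow>
   ('w \<Rightarrow> 'k) \<Rightarrow> ('k, 'v, 'w) tensor \<Rightarrow> 'v" where
  "contract_right sV sW f = tensor_lift sV sW (\<lambda>v w. sV (f w) v)"

definition contract_left ::
  "('k::field \<Rightarrow> 'v::ab_group_add \<Rightarrow> 'v) \<Rightarrow> ('k \<Rightarrow> 'w::ab_group_add \<Rightarrow> 'w) \<Rightarrow>
   ('v \<Rightarrow> 'k) \<Rightarrow> ('k, 'v, 'w) tensor \<Rightarrow> 'w" where
  "contract_left sV sW f = tensor_lift sV sW (\<lambda>v w. sW (f v) w)"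

lemma bilinear_contract_right:
  assumes "vector_space sV" "linear_functional sW f"
  shows "bilinear_map sV sW sV (\<lambda>v w. sV (f w) v)"
proof -
  interpret vector_space sV by fact
  show ?thesis
    using assms by (auto simp: bilinear_map_def linear_map_iff algebra_simps)
qed

lemma bilinear_contract_left:
  assumes "vector_space sW" "linear_functional sV f"
  shows "bilinear_map sV sW sW (\<lambda>v w. sW (f v) w)"
proof -
  interpret vector_space sW by fact
  show ?thesis
    using assms by (auto simp: bilinear_map_def linear_map_iff algebra_simps)
qed

lemma contract_right_sum:
  assumes "vector_space sV" "linear_functional sW f"
  shows "contract_right sV sW f (\<Sum>(v, w)\<leftarrow>xs. pure_tensor sV sW v w) = (\<Sum>(v, w)\<leftarrow>xs. sV (f w) v)"
  unfolding contract_right_def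
  by (rule tensor_lift_sum_list[OF bilinear_contract_right[OF assms]])

lemma contract_left_sum:
  assumes "vector_space sW" "linear_functional sV f"
  shows "contract_left sV sW f (\<Sum>(v, w)\<leftarrow>xs. pure_tensor sV sW v w) = (\<Sum>(v, w)\<leftarrow>xs. sW (f v) w)"
  unfolding contract_left_def
  by (rule tensor_lift_sum_list[OF bilinear_contract_left[OF assms]])

lemma contract_right_in:
  assumes "vector_space sV" "linear_functional sW f" "module.subspace sV A"
    "t \<in> tensor_subspace sV sW A B"
  shows "contract_right sV sW f t \<in> A"
proof -
  interpret vector_space sV by fact
  show ?thesis
    unfolding contract_right_def
    using tensor_lift_in_subspace[OF bilinear_contract_right[OF assms(1,2)] assms(3,4)]
      subspace_scale[OF assms(3)] by blast
qed

lemma contract_left_in: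
  assumes "vector_space sW" "linear_functional sV f" "module.subspace sW B"
    "t \<in> tensor_subspace sV sW A B"
  shows "contract_left sV sW f t \<in> B"
proof -
  interpret vector_space sW by fact
  show ?thesis
    unfolding contract_left_def
    using tensor_lift_in_subspace[OF bilinear_contract_left[OF assms(1,2)] assms(3,4)]
      subspace_scale[OF assms(3)] by blast
qed

text \<open>A linear combination of pure tensors becomes a plain sum by absorbing the scalars into
  the left factor, which is why \<open>A\<close> is assumed to be a subspace.\<close>

lemma tensor_subspace_sum_list:
  assumes "vector_space sV" "vector_space sW" "module.subspace sV A" "t \<in> tensor_subspace sV sW A B"
  obtains xs where "t = (\<Sum>(v, w)\<leftarrow>xs. pure_tensor sV sW v w)" "set xs \<subseteq> A \<times> B"
proof -
  interpret V: vector_space sV by fact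
  note pure = bilinear_pure_tensor[OF assms(1,2)]
  let ?T = "{t. \<exists>xs. t = (\<Sum>(v, w)\<leftarrow>xs. pure_tensor sV sW v w) \<and> set xs \<subseteq> A \<times> B}"
  have "module.subspace fun_scale ?T"
  proof (rule module.subspaceI[OF module_fun_scale])
    show "0 \<in> ?T"
      by (auto intro: exI[of _ "[]"])
    show "x + y \<in> ?T" if "x \<in> ?T" "y \<in> ?T" for x y
    proof -
      from that obtain xs ys where
        "x = (\<Sum>(v, w)\<leftarrow>xs. pure_tensor sV sW v w)" "set xs \<subseteq> A \<times> B"
        "y = (\<Sum>(v, w)\<leftarrow>ys. pure_tensor sV sW v w)" "set ys \<subseteq> A \<times> B" by blast
      then show ?thesis
        by (intro CollectI exI[of _ "xs @ ys"]) auto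
    qed
    show "fun_scale c x \<in> ?T" if "x \<in> ?T" for c x
    proof -
      from that obtain xs where x: "x = (\<Sum>(v, w)\<leftarrow>xs. pure_tensor sV sW v w)" "set xs \<subseteq> A \<times> B"
        by blast
      show ?thesis
        unfolding x(1) sum_list_scale_left[OF pure]
        using x(2) V.subspace_scale[OF assms(3)]
        by (intro CollectI exI[of _ "map (\<lambda>(v, w). (sV c v, w)) xs"]) auto
    qed
  qed
  then have "tensor_subspace sV sW A B \<subseteq> ?T"
    unfolding tensor_subspace_def
    by (intro module.span_minimal[OF module_fun_scale]) (fastforce intro: exI[of _ "[(a, b)]" for a b])
  with assms(4) that show ?thesis by blast
qed

text \<open>Prepares the extraction of coefficients: once \<open>F\<close> is independent, the
  vector \<open>u b\<close> is the slice along the functional dual to \<open>b\<close>.\<close>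

lemma regroup_tensor_right:
  assumes "vector_space sV" "vector_space sW" "finite F" "snd ` set xs \<subseteq> module.span sW F"
  shows "\<exists>u. (\<Sum>(v, w)\<leftarrow>xs. pure_tensor sV sW v w) = (\<Sum>b\<in>F. pure_tensor sV sW (u b) b)"
proof -
  interpret V: vector_space sV by fact
  interpret W: vector_space sW by fact
  note pure = bilinear_pure_tensor[OF assms(1,2)]
  note p1 = linear_map_simps[OF bilinear_mapD(4)[OF pure]]
  note p2 = linear_map_simps[OF bilinear_mapD(5)[OF pure]]
  show ?thesis
    using assms(4)
  proof (induction xs)
    case Nil
    show ?case by (rule exI[of _ "\<lambda>_. 0"]) (simp add: p1)
  next
    case (Cons x xs)
    obtain v w where x: "x = (v, w)" by force
    from Cons obtain u where
      u: "(\<Sum>(v, w)\<leftarrow>xs. pure_tensor sV sW v w) = (\<Sum>b\<in>F. pure_tensor sV sW (u b) b)"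
      by auto
    have "w \<in> W.span F" using Cons.prems x by simp
    then obtain c where c: "w = (\<Sum>b\<in>F. sW (c b) b)"
      using W.span_finite[OF assms(3)] by auto
    have "pure_tensor sV sW v w = (\<Sum>b\<in>F. pure_tensor sV sW (sV (c b) v) b)"
      unfolding c p2 p1 ..
    then show ?case
      by (intro exI[of _ "\<lambda>b. sV (c b) v + u b"]) (simp only: x u p1 sum.distrib list.map sum_list.Cons prod.case)
  qed
qed

lemma regroup_tensor_left:
  assumes "vector_space sV" "vector_space sW" "finite F" "fst ` set xs \<subseteq> module.span sV F"
  shows "\<exists>u. (\<Sum>(v, w)\<leftarrow>xs. pure_tensor sV sW v w) = (\<Sum>a\<in>F. pure_tensor sV sW a (u a))"
proof -
  interpret V: vector_space sV by fact
  interpret W: vector_space sW by fact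
  note pure = bilinear_pure_tensor[OF assms(1,2)]
  note p1 = linear_map_simps[OF bilinear_mapD(4)[OF pure]]
  note p2 = linear_map_simps[OF bilinear_mapD(5)[OF pure]]
  show ?thesis
    using assms(4)
  proof (induction xs)
    case Nil
    show ?case by (rule exI[of _ "\<lambda>_. 0"]) (simp add: p2)
  next
    case (Cons x xs)
    obtain v w where x: "x = (v, w)" by force
    from Cons obtain u where
      u: "(\<Sum>(v, w)\<leftarrow>xs. pure_tensor sV sW v w) = (\<Sum>a\<in>F. pure_tensor sV sW a (u a))"
      by auto
    have "v \<in> V.span F" using Cons.prems x by simp
    then obtain c where c: "v = (\<Sum>a\<in>F. sV (c a) a)"
      using V.span_finite[OF assms(3)] by auto
    have "pure_tensor sV sW v w = (\<Sum>a\<in>F. pure_tensor sV sW a (sW (c a) w))"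
      unfolding c p2 p1 ..
    then show ?case
      by (intro exI[of _ "\<lambda>a. sW (c a) w + u a"]) (simp only: x u p2 sum.distrib list.map sum_list.Cons prod.case)
  qed
qed

lemma sum_pure_tensor_in:
  assumes "\<And>i. i \<in> I \<Longrightarrow> f i \<in> A" "\<And>i. i \<in> I \<Longrightarrow> g i \<in> B"
  shows "(\<Sum>i\<in>I. pure_tensor sV sW (f i) (g i)) \<in> tensor_subspace sV sW A B"
  using assms
  by (induction I rule: infinite_finite_induct)
    (simp_all only: sum.infinite sum.empty sum.insert tensor_subspace_ops pure_tensor_in insert_iff simp_thms)

lemma tensor_lift_sum:
  assumes "bilinear_map sV sW sU f"
  shows "tensor_lift sV sW f (\<Sum>i\<in>I. pure_tensor sV sW (g i) (h i)) = (\<Sum>i\<in>I. f (g i) (h i))"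
proof (induction I rule: infinite_finite_induct)
  case (insert i I)
  have "tensor_lift sV sW f (pure_tensor sV sW (g i) (h i) + (\<Sum>i\<in>I. pure_tensor sV sW (g i) (h i))) =
      f (g i) (h i) + (\<Sum>i\<in>I. f (g i) (h i))"
    by (subst tensor_lift_add[OF assms])
      (simp_all only: pure_tensor_in sum_pure_tensor_in UNIV_I tensor_lift_pure[OF assms] insert.IH)
  then show ?case
    by (simp only: sum.insert[OF insert.hyps] not_False_eq_True)
qed (simp_all only: sum.infinite sum.empty not_False_eq_True tensor_lift_zero[OF assms])

text \<open>Converse to \<open>contract_right_in\<close>: when the right legs are linearly
  independent, each left leg is itself a slice of \<open>t\<close>, taken along a dual
  functional.\<close>

lemma tensor_in_if_contract_right_in:
  assumes vs: "vector_space sV" "vector_space sW" and t: "t \<in> tensor_space sV sW"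
    and A: "\<And>f. linear_functional sW f \<Longrightarrow> contract_right sV sW f t \<in> A"
  shows "t \<in> tensor_subspace sV sW A UNIV"
proof -
  interpret V: vector_space sV by fact
  interpret W: vector_space sW by fact
  obtain xs where xs: "t = (\<Sum>(v, w)\<leftarrow>xs. pure_tensor sV sW v w)"
    using t tensor_space_iff[OF vs] by blast
  obtain F where F: "finite F" "W.independent F" "W.span F = W.span (snd ` set xs)"
    by (rule W.finite_basis_of_span[of "snd ` set xs"]) simp
  have "snd ` set xs \<subseteq> W.span F"
    unfolding F(3) by (rule W.span_superset)
  from regroup_tensor_right[OF vs F(1) this]
  obtain u where u: "t = (\<Sum>b\<in>F. pure_tensor sV sW (u b) b)"
    unfolding xs by (elim exE)
  have "u b \<in> A" if b: "b \<in> F" for b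
  proof -
    obtain \<phi> where \<phi>: "linear_functional sW \<phi>" "\<forall>x\<in>F. \<phi> x = (if x = b then 1 else 0)"
      by (rule functional_dual_to_independent[OF vs(2) F(2) b])
    have "contract_right sV sW \<phi> t = (\<Sum>x\<in>F. sV (\<phi> x) (u x))"
      unfolding u contract_right_def by (rule tensor_lift_sum[OF bilinear_contract_right[OF vs(1) \<phi>(1)]])
    also have "\<dots> = (\<Sum>x\<in>F. if x = b then u x else 0)"
      using \<phi>(2) by (intro sum.cong) auto
    also have "\<dots> = u b"
      using F(1) b by simp
    finally show ?thesis
      using A[OF \<phi>(1)] by simp
  qed
  then show ?thesis
    unfolding u by (intro sum_pure_tensor_in) auto
qed

text \<open>In effect the intersection of \<open>A \<otimes> W\<close> and
  \<open>V \<otimes> B\<close> is \<open>A \<otimes> B\<close>. The first family of slices brings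
  the left legs into \<open>A\<close>; rewriting over a basis of their span keeps them in
  \<open>A\<close> and exhibits the right legs as slices of the second family.\<close>

lemma tensor_in_if_contractions_in:
  assumes vs: "vector_space sV" "vector_space sW" and t: "t \<in> tensor_space sV sW"
    and sub: "module.subspace sV A"
    and A: "\<And>f. linear_functional sW f \<Longrightarrow> contract_right sV sW f t \<in> A"
    and B: "\<And>f. linear_functional sV f \<Longrightarrow> contract_left sV sW f t \<in> B"
  shows "t \<in> tensor_subspace sV sW A B"
proof -
  interpret V: vector_space sV by fact
  interpret W: vector_space sW by fact
  obtain xs where xs: "t = (\<Sum>(v, w)\<leftarrow>xs. pure_tensor sV sW v w)" "set xs \<subseteq> A \<times> UNIV"
    by (rule tensor_subspace_sum_list[OF vs sub tensor_in_if_contract_right_in[OF vs t A]])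
  obtain F where F: "finite F" "V.independent F" "V.span F = V.span (fst ` set xs)"
      "F \<subseteq> V.span (fst ` set xs)"
    by (rule V.finite_basis_of_span[of "fst ` set xs"]) simp
  have "fst ` set xs \<subseteq> V.span F"
    unfolding F(3) by (rule V.span_superset)
  from regroup_tensor_left[OF vs F(1) this]
  obtain u where u: "t = (\<Sum>a\<in>F. pure_tensor sV sW a (u a))"
    unfolding xs(1) by (elim exE)
  have "V.span (fst ` set xs) \<subseteq> A"
    using xs(2) sub by (intro V.span_minimal) auto
  with F(4) have "F \<subseteq> A"
    by (rule subset_trans)
  moreover have "u a \<in> B" if a: "a \<in> F" for a
  proof -
    obtain \<phi> where \<phi>: "linear_functional sV \<phi>" "\<forall>x\<in>F. \<phi> x = (if x = a then 1 else 0)"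
      by (rule functional_dual_to_independent[OF vs(1) F(2) a])
    have "contract_left sV sW \<phi> t = (\<Sum>x\<in>F. sW (\<phi> x) (u x))"
      unfolding u contract_left_def by (rule tensor_lift_sum[OF bilinear_contract_left[OF vs(2) \<phi>(1)]])
    also have "\<dots> = (\<Sum>x\<in>F. if x = a then u x else 0)"
      using \<phi>(2) by (intro sum.cong) auto
    also have "\<dots> = u a"
      using F(1) a by simp
    finally show ?thesis
      using B[OF \<phi>(1)] by simp
  qed
  ultimately show ?thesis
    unfolding u by (intro sum_pure_tensor_in) auto
qed

section \<open>Pointed coalgebras\<close>

lemma sum_list_concat: "sum_list (concat xss) = sum_list (map sum_list xss)"
  by (induction xss) simp_all

lemma (in module) sum_list_in_subspace:
  assumes "subspace X" "\<And>x. x \<in> set xs \<Longrightarrow> f x \<in> X"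
  shows "(\<Sum>x\<leftarrow>xs. f x) \<in> X"
  using assms(2) by (induction xs) (simp_all add: subspace_0[OF assms(1)] subspace_add[OF assms(1)])

context coalgebra
begin

section \<open>Sweedler sums and the two actions of the dual algebra\<close>

lemma comult_sum_list:
  obtains xs where "\<Delta> h = (\<Sum>(a, b)\<leftarrow>xs. pure_tensor scale scale a b)"
  using comult_closed tensor_space_iff[OF vector_space_axioms vector_space_axioms] by blast

lemma linear_lift_comult:
  assumes "bilinear_map scale scale sU f"
  shows "Vector_Spaces.linear scale sU (\<lambda>h. tensor_lift scale scale f (\<Delta> h))"
  using bilinear_mapD(3)[OF assms] vector_space_axioms
  by (simp add: linear_map_iff linear_map_simps(2,3)[OF linear_comult] comult_closed
      tensor_lift_add[OF assms] tensor_lift_scale[OF assms])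

lemma bilinear_nested_left:
  assumes "\<And>v w. Vector_Spaces.linear scale sX (\<lambda>u. f u v w)"
    and "\<And>u w. Vector_Spaces.linear scale sX (\<lambda>v. f u v w)"
    and "\<And>u v. Vector_Spaces.linear scale sX (\<lambda>w. f u v w)"
  shows "bilinear_map scale scale sX (\<lambda>a b. tensor_lift scale scale (\<lambda>x y. f x y b) (\<Delta> a))"
  unfolding bilinear_map_def using assms
  by (auto intro!: linear_lift_comult linear_tensor_lift_parameter comult_closed simp: bilinear_map_def)

lemma bilinear_nested_right:
  assumes "\<And>v w. Vector_Spaces.linear scale sX (\<lambda>u. f u v w)"
    and "\<And>u w. Vector_Spaces.linear scale sX (\<lambda>v. f u v w)"
    and "\<And>u v. Vector_Spaces.linear scale sX (\<lambda>w. f u v w)"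
  shows "bilinear_map scale scale sX (\<lambda>a b. tensor_lift scale scale (\<lambda>x y. f a x y) (\<Delta> b))"
  unfolding bilinear_map_def using assms
  by (auto intro!: linear_lift_comult linear_tensor_lift_parameter comult_closed simp: bilinear_map_def)

text \<open>The axiom is an identity between threefold tensors. Written with Sweedler lists, both
  sides become sums of pure threefold tensors, and the universal property carries the equality over
  to any trilinear \<open>f\<close>.\<close>

lemma coassoc_trilinear:
  assumes f: "\<And>v w. Vector_Spaces.linear scale sX (\<lambda>u. f u v w)"
      "\<And>u w. Vector_Spaces.linear scale sX (\<lambda>v. f u v w)"
      "\<And>u v. Vector_Spaces.linear scale sX (\<lambda>w. f u v w)"
  shows "tensor_lift scale scale (\<lambda>a b. tensor_lift scale scale (\<lambda>x y. f x y b) (\<Delta> a)) (\<Delta> h) =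
    tensor_lift scale scale (\<lambda>a b. tensor_lift scale scale (\<lambda>x y. f a x y) (\<Delta> b)) (\<Delta> h)"
proof -
  \<comment> \<open>A fixed Sweedler list for every element, so that the inner sums can be written
    as functions of the outer components.\<close>
  define D where "D a = (SOME xs. \<Delta> a = (\<Sum>(a, b)\<leftarrow>xs. pure_tensor scale scale a b))" for a
  have D: "\<Delta> a = (\<Sum>(a, b)\<leftarrow>D a. pure_tensor scale scale a b)" for a
    unfolding D_def by (rule someI_ex) (meson comult_sum_list)
  define l where "l = concat (map (\<lambda>(a, b). map (\<lambda>(x, y). (x, y, b)) (D a)) (D h))"
  define r where "r = concat (map (\<lambda>(a, b). map (\<lambda>(x, y). (a, x, y)) (D b)) (D h))"
  \<comment> \<open>The target is arbitrary because this is applied twice, to the universal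
    \<open>pure_tensor3\<close> and to \<open>f\<close>.\<close>
  have nested_l: "tensor_lift scale scale (\<lambda>a b. tensor_lift scale scale (\<lambda>x y. g x y b) (\<Delta> a)) (\<Delta> h) =
      (\<Sum>(x, y, z)\<leftarrow>l. g x y z)"
    if g: "\<And>v w. Vector_Spaces.linear scale sU (\<lambda>u. g u v w)"
      "\<And>u w. Vector_Spaces.linear scale sU (\<lambda>v. g u v w)"
      "\<And>u v. Vector_Spaces.linear scale sU (\<lambda>w. g u v w)"
    for g :: "'h \<Rightarrow> 'h \<Rightarrow> 'h \<Rightarrow> 'u::ab_group_add" and sU
  proof -
    have b: "bilinear_map scale scale sU (\<lambda>x y. g x y z)" for z
      using g by (simp add: bilinear_map_def)
    have "tensor_lift scale scale (\<lambda>a b. tensor_lift scale scale (\<lambda>x y. g x y b) (\<Delta> a)) (\<Delta> h) =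
        (\<Sum>(a, b)\<leftarrow>D h. tensor_lift scale scale (\<lambda>x y. g x y b) (\<Delta> a))"
      by (subst (2) D) (rule tensor_lift_sum_list[OF bilinear_nested_left[OF g]])
    also have "\<dots> = (\<Sum>(a, b)\<leftarrow>D h. \<Sum>(x, y)\<leftarrow>D a. g x y b)"
      by (subst D) (simp only: tensor_lift_sum_list[OF b])
    also have "\<dots> = (\<Sum>(x, y, z)\<leftarrow>l. g x y z)"
      by (simp add: l_def sum_list_concat map_concat comp_def case_prod_unfold)
    finally show ?thesis .
  qed
  have nested_r: "tensor_lift scale scale (\<lambda>a b. tensor_lift scale scale (\<lambda>x y. g a x y) (\<Delta> b)) (\<Delta> h) =
      (\<Sum>(x, y, z)\<leftarrow>r. g x y z)"
    if g: "\<And>v w. Vector_Spaces.linear scale sU (\<lambda>u. g u v w)"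
      "\<And>u w. Vector_Spaces.linear scale sU (\<lambda>v. g u v w)"
      "\<And>u v. Vector_Spaces.linear scale sU (\<lambda>w. g u v w)"
    for g :: "'h \<Rightarrow> 'h \<Rightarrow> 'h \<Rightarrow> 'u::ab_group_add" and sU
  proof -
    have b: "bilinear_map scale scale sU (\<lambda>x y. g a x y)" for a
      using g by (simp add: bilinear_map_def)
    have "tensor_lift scale scale (\<lambda>a b. tensor_lift scale scale (\<lambda>x y. g a x y) (\<Delta> b)) (\<Delta> h) =
        (\<Sum>(a, b)\<leftarrow>D h. tensor_lift scale scale (\<lambda>x y. g a x y) (\<Delta> b))"
      by (subst (2) D) (rule tensor_lift_sum_list[OF bilinear_nested_right[OF g]])
    also have "\<dots> = (\<Sum>(a, b)\<leftarrow>D h. \<Sum>(x, y)\<leftarrow>D b. g a x y)"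
      by (subst D) (simp only: tensor_lift_sum_list[OF b])
    also have "\<dots> = (\<Sum>(x, y, z)\<leftarrow>r. g x y z)"
      by (simp add: r_def sum_list_concat map_concat comp_def case_prod_unfold)
    finally show ?thesis .
  qed
  let ?p = "pure_tensor3 scale scale scale"
  have p: "Vector_Spaces.linear scale fun_scale (\<lambda>u. ?p u v w)"
    "Vector_Spaces.linear scale fun_scale (\<lambda>u. ?p v u w)"
    "Vector_Spaces.linear scale fun_scale (\<lambda>u. ?p v w u)" for v w
    by (auto simp: linear_map_iff vector_space_axioms vector_space_fun_scale fun_eq_iff plus_fun_def
        pure_tensor3_def fun_scale_def trilinear_form_def)
  have "(\<Sum>(x, y, z)\<leftarrow>l. ?p x y z) = (\<Sum>(x, y, z)\<leftarrow>r. ?p x y z)"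
    by (rule trans[OF nested_l[OF p, symmetric] trans[OF coassoc nested_r[OF p]]])
  from pure_tensor3_universal[OF f this] show ?thesis
    by (simp only: nested_l[OF f] nested_r[OF f])
qed

text \<open>The usual left and right actions of the dual algebra:
  \<open>lhit f h = \<Sum> f(h\<^sub>2) h\<^sub>1\<close> and \<open>rhit f h = \<Sum> f(h\<^sub>1) h\<^sub>2\<close>.\<close>

definition lhit :: "('h \<Rightarrow> 'k) \<Rightarrow> 'h \<Rightarrow> 'h" where
  "lhit f h = contract_right scale scale f (\<Delta> h)"

definition rhit :: "('h \<Rightarrow> 'k) \<Rightarrow> 'h \<Rightarrow> 'h" where
  "rhit f h = contract_left scale scale f (\<Delta> h)"

lemma linear_lhit: "linear_functional scale f \<Longrightarrow> Vector_Spaces.linear scale scale (lhit f)"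
  unfolding lhit_def contract_right_def
  by (intro linear_lift_comult bilinear_contract_right vector_space_axioms)

lemma linear_rhit: "linear_functional scale f \<Longrightarrow> Vector_Spaces.linear scale scale (rhit f)"
  unfolding rhit_def contract_left_def
  by (intro linear_lift_comult bilinear_contract_left vector_space_axioms)

lemma lift_comult_lhit:
  assumes "linear_functional scale f" "Vector_Spaces.linear scale sX \<phi>"
  shows "\<phi> (lhit f h) = tensor_lift scale scale (\<lambda>a b. sX (f b) (\<phi> a)) (\<Delta> h)"
  unfolding lhit_def contract_right_def
  by (subst tensor_lift_compose[OF bilinear_contract_right assms(2) comult_closed])
    (use assms vector_space_axioms linear_map_simps(3)[OF assms(2)] in simp_all)

lemma lift_comult_rhit:
  assumes "linear_functional scale f" "Vector_Spaces.linear scale sX \<phi>"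
  shows "\<phi> (rhit f h) = tensor_lift scale scale (\<lambda>a b. sX (f a) (\<phi> b)) (\<Delta> h)"
  unfolding rhit_def contract_left_def
  by (subst tensor_lift_compose[OF bilinear_contract_left assms(2) comult_closed])
    (use assms vector_space_axioms linear_map_simps(3)[OF assms(2)] in simp_all)

text \<open>Both sides are the convolution product \<open>g * f\<close> evaluated at
  \<open>h\<close>.\<close>

lemma functional_hit_swap:
  assumes "linear_functional scale f" "linear_functional scale g"
  shows "f (rhit g h) = g (lhit f h)"
  by (simp add: lift_comult_rhit[OF assms(2,1)] lift_comult_lhit[OF assms] mult.commute)

lemma lhit_counit: "lhit \<epsilon> h = h"
  unfolding lhit_def contract_right_def by (rule counit_right)

lemma rhit_counit: "rhit \<epsilon> h = h"
  unfolding rhit_def contract_left_def by (rule counit_left)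

lemma counit_rhit: "linear_functional scale f \<Longrightarrow> \<epsilon> (rhit f h) = f h"
  using functional_hit_swap[OF linear_counit] by (simp add: lhit_counit)

lemma linear_scale_functional:
  assumes "linear_functional scale f"
  shows "Vector_Spaces.linear scale scale (\<lambda>a. scale (f a) x)"
  using assms by (auto simp: linear_map_iff algebra_simps vector_space_axioms)

lemma linear_scale: "Vector_Spaces.linear scale scale (scale c)"
  by (auto simp: linear_map_iff algebra_simps vector_space_axioms)

lemma linear_scale_comp:
  assumes "Vector_Spaces.linear scale scale f"
  shows "Vector_Spaces.linear scale scale (\<lambda>x. scale c (f x))"
  by (rule linear_functional_comp[OF assms linear_scale])

text \<open>The functional on the right is the convolution product \<open>g * f\<close>, so this is
  the module law over the dual algebra. With the next two lemmas, \<open>lhit\<close> and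
  \<open>rhit\<close> make the coalgebra a bimodule over its dual.\<close>

lemma lhit_lhit:
  assumes f: "linear_functional scale f" and g: "linear_functional scale g"
  shows "lhit g (lhit f h) = lhit (\<lambda>x. f (rhit g x)) h"
proof -
  have "lhit g (lhit f h) = tensor_lift scale scale (\<lambda>a b. scale (f b) (lhit g a)) (\<Delta> h)"
    by (rule lift_comult_lhit[OF f linear_lhit[OF g]])
  also have "\<dots> = tensor_lift scale scale
      (\<lambda>a b. tensor_lift scale scale (\<lambda>x y. scale (g y) (scale (f b) x)) (\<Delta> a)) (\<Delta> h)"
    by (simp only: lift_comult_lhit[OF g linear_scale])
  also have "\<dots> = tensor_lift scale scale
      (\<lambda>a b. tensor_lift scale scale (\<lambda>x y. scale (g x) (scale (f y) a)) (\<Delta> b)) (\<Delta> h)"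
    by (rule coassoc_trilinear[where sX = scale]) (intro linear_scale linear_scale_comp linear_scale_functional f g)+
  also have "\<dots> = tensor_lift scale scale (\<lambda>a b. scale (f (rhit g b)) a) (\<Delta> h)"
    by (simp only: lift_comult_rhit[OF g linear_scale_functional[OF f]])
  finally show ?thesis
    by (simp only: lhit_def contract_right_def)
qed

lemma rhit_rhit:
  assumes f: "linear_functional scale f" and g: "linear_functional scale g"
  shows "rhit g (rhit f h) = rhit (\<lambda>x. f (lhit g x)) h"
proof -
  have "rhit g (rhit f h) = tensor_lift scale scale (\<lambda>a b. scale (f a) (rhit g b)) (\<Delta> h)"
    by (rule lift_comult_rhit[OF f linear_rhit[OF g]])
  also have "\<dots> = tensor_lift scale scale
      (\<lambda>a b. tensor_lift scale scale (\<lambda>x y. scale (g x) (scale (f a) y)) (\<Delta> b)) (\<Delta> h)"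
    by (simp only: lift_comult_rhit[OF g linear_scale])
  also have "\<dots> = tensor_lift scale scale
      (\<lambda>a b. tensor_lift scale scale (\<lambda>x y. scale (g y) (scale (f x) b)) (\<Delta> a)) (\<Delta> h)"
    by (rule coassoc_trilinear[where sX = scale, symmetric])
      (intro linear_scale linear_scale_comp linear_scale_functional f g)+
  also have "\<dots> = tensor_lift scale scale (\<lambda>a b. scale (f (lhit g a)) b) (\<Delta> h)"
    by (simp only: lift_comult_lhit[OF g linear_scale_functional[OF f]])
  finally show ?thesis
    by (simp only: rhit_def contract_left_def)
qed

lemma lhit_rhit:
  assumes f: "linear_functional scale f" and g: "linear_functional scale g"
  shows "lhit g (rhit f h) = rhit f (lhit g h)"
proof -
  have "rhit f (lhit g h) = tensor_lift scale scale (\<lambda>a b. scale (g b) (rhit f a)) (\<Delta> h)"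
    by (rule lift_comult_lhit[OF g linear_rhit[OF f]])
  also have "\<dots> = tensor_lift scale scale
      (\<lambda>a b. tensor_lift scale scale (\<lambda>x y. scale (f x) (scale (g b) y)) (\<Delta> a)) (\<Delta> h)"
    by (simp only: lift_comult_rhit[OF f linear_scale])
  also have "\<dots> = tensor_lift scale scale
      (\<lambda>a b. tensor_lift scale scale (\<lambda>x y. scale (f a) (scale (g y) x)) (\<Delta> b)) (\<Delta> h)"
    by (rule coassoc_trilinear[where sX = scale]) (intro linear_scale linear_scale_comp linear_scale_functional f g)+
  also have "\<dots> = tensor_lift scale scale (\<lambda>a b. scale (f a) (lhit g b)) (\<Delta> h)"
    by (simp only: lift_comult_lhit[OF g linear_scale] scale_left_commute)
  also have "\<dots> = lhit g (rhit f h)"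
    by (rule lift_comult_rhit[OF f linear_lhit[OF g], symmetric])
  finally show ?thesis ..
qed

section \<open>Subcoalgebras, right coideals and their local finiteness\<close>

lemma finite_span_lhit:
  obtains B where "finite B" "\<forall>f. linear_functional scale f \<longrightarrow> lhit f h \<in> span B"
proof -
  obtain xs where xs: "\<Delta> h = (\<Sum>(a, b)\<leftarrow>xs. pure_tensor scale scale a b)"
    by (rule comult_sum_list)
  have "lhit f h \<in> span (fst ` set xs)" if "linear_functional scale f" for f
    unfolding lhit_def xs contract_right_sum[OF vector_space_axioms that]
    by (rule sum_list_in_subspace[OF subspace_span]) (simp add: case_prod_unfold span_scale span_base)
  then show ?thesis
    using that[of "fst ` set xs"] by simp
qed

lemma finite_span_rhit:
  obtains B where "finite B" "\<forall>f. linear_functional scale f \<longrightarrow> rhit f h \<in> span B"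
proof -
  obtain xs where xs: "\<Delta> h = (\<Sum>(a, b)\<leftarrow>xs. pure_tensor scale scale a b)"
    by (rule comult_sum_list)
  have "rhit f h \<in> span (snd ` set xs)" if "linear_functional scale f" for f
    unfolding rhit_def xs contract_left_sum[OF vector_space_axioms that]
    by (rule sum_list_in_subspace[OF subspace_span]) (simp add: case_prod_unfold span_scale span_base)
  then show ?thesis
    using that[of "snd ` set xs"] by simp
qed

text \<open>Subcoalgebras are exactly the sub-bimodules over the dual algebra; this direction rests
  on testing tensors by slices.\<close>

lemma subcoalgebraI:
  assumes "subspace D"
    and "\<And>f d. linear_functional scale f \<Longrightarrow> d \<in> D \<Longrightarrow> lhit f d \<in> D"
    and "\<And>f d. linear_functional scale f \<Longrightarrow> d \<in> D \<Longrightarrow> rhit f d \<in> D"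
  shows "subcoalgebra D"
  unfolding subcoalgebra_def
  using assms unfolding lhit_def rhit_def
  by (auto intro!: tensor_in_if_contractions_in vector_space_axioms comult_closed)

lemma subcoalgebra_lhit:
  "subcoalgebra D \<Longrightarrow> linear_functional scale f \<Longrightarrow> d \<in> D \<Longrightarrow> lhit f d \<in> D"
  unfolding subcoalgebra_def lhit_def by (auto intro: contract_right_in vector_space_axioms)

lemma subcoalgebra_rhit:
  "subcoalgebra D \<Longrightarrow> linear_functional scale f \<Longrightarrow> d \<in> D \<Longrightarrow> rhit f d \<in> D"
  unfolding subcoalgebra_def rhit_def by (auto intro: contract_left_in vector_space_axioms)

text \<open>The slicewise form of \<open>\<Delta> N \<subseteq> N \<otimes> H\<close>: a right
  subcomodule is a submodule for the action \<open>lhit\<close> of the dual algebra.\<close>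

definition right_coideal :: "'h set \<Rightarrow> bool" where
  "right_coideal N \<longleftrightarrow> subspace N \<and> (\<forall>f n. linear_functional scale f \<longrightarrow> n \<in> N \<longrightarrow> lhit f n \<in> N)"

lemma right_coidealD:
  assumes "right_coideal N"
  shows "subspace N" "linear_functional scale f \<Longrightarrow> n \<in> N \<Longrightarrow> lhit f n \<in> N"
  using assms by (auto simp: right_coideal_def)

lemma linear_map_span:
  assumes "Vector_Spaces.linear scale scale f" "\<And>s. s \<in> S \<Longrightarrow> f s \<in> span S" "x \<in> span S"
  shows "f x \<in> span S"
  using assms(3)
proof (induction rule: span_induct_alt)
  case base
  show ?case by (simp add: linear_map_simps[OF assms(1)] span_zero)
next
  case (step c x y)
  then show ?case
    by (simp add: linear_map_simps[OF assms(1)] span_add span_scale assms(2))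
qed

lemma right_coideal_span:
  assumes "\<And>f s. linear_functional scale f \<Longrightarrow> s \<in> S \<Longrightarrow> lhit f s \<in> span S"
  shows "right_coideal (span S)"
  unfolding right_coideal_def using assms linear_map_span[OF linear_lhit]
  by (auto simp: subspace_span)

lemma subcoalgebra_span:
  assumes "\<And>f s. linear_functional scale f \<Longrightarrow> s \<in> S \<Longrightarrow> lhit f s \<in> span S"
    and "\<And>f s. linear_functional scale f \<Longrightarrow> s \<in> S \<Longrightarrow> rhit f s \<in> span S"
  shows "subcoalgebra (span S)"
  using assms linear_map_span[OF linear_lhit] linear_map_span[OF linear_rhit]
  by (intro subcoalgebraI subspace_span) auto

lemma functional_lhit: "linear_functional scale f \<Longrightarrow> linear_functional scale g \<Longrightarrow>
    linear_functional scale (\<lambda>x. f (lhit g x))"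
  by (rule linear_functional_comp[OF linear_lhit])

lemma functional_rhit: "linear_functional scale f \<Longrightarrow> linear_functional scale g \<Longrightarrow>
    linear_functional scale (\<lambda>x. f (rhit g x))"
  by (rule linear_functional_comp[OF linear_rhit])

text \<open>Local finiteness of comodules. \<open>D\<close> is the orbit of \<open>h\<close> under
  the dual algebra: it contains \<open>h\<close> because the counit acts as the identity, and the
  left legs of a single expression of \<open>\<Delta> h\<close> span a space containing it.\<close>

lemma right_coideal_generated:
  obtains D B where "right_coideal D" "h \<in> D" "finite B" "D \<subseteq> span B"
    "\<forall>K. subcoalgebra K \<longrightarrow> h \<in> K \<longrightarrow> D \<subseteq> K"
proof -
  let ?S = "{lhit f h | f. linear_functional scale f}"
  obtain B where B: "finite B" "\<forall>f. linear_functional scale f \<longrightarrow> lhit f h \<in> span B"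
    by (rule finite_span_lhit)
  have "right_coideal (span ?S)"
  proof (rule right_coideal_span)
    fix f s assume f: "linear_functional scale f" and "s \<in> ?S"
    then obtain g where g: "linear_functional scale g" "s = lhit g h" by blast
    have "lhit f s = lhit (\<lambda>x. g (rhit f x)) h"
      using lhit_lhit[OF g(1) f] g(2) by simp
    then show "lhit f s \<in> span ?S"
      using functional_rhit[OF g(1) f] by (intro span_base) blast
  qed
  moreover have "h \<in> span ?S"
    using lhit_counit[of h] linear_counit by (intro span_base) force
  moreover have "span ?S \<subseteq> span B"
    using B(2) by (intro span_minimal) auto
  moreover have "span ?S \<subseteq> K" if "subcoalgebra K" "h \<in> K" for K
    using that subcoalgebra_lhit[OF that(1)]
    by (intro span_minimal) (auto simp: subcoalgebra_def)
  ultimately show ?thesis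
    using B(1) by (intro that[of "span ?S" B]) auto
qed

text \<open>The fundamental theorem of coalgebras: take a finite-dimensional right coideal
  \<open>R\<close> and close it under \<open>rhit\<close>. As the two actions commute, the result is
  stable under both.\<close>

lemma subcoalgebra_generated_in:
  assumes C: "subcoalgebra C" "C \<noteq> {0}"
  obtains D B where "subcoalgebra D" "D \<noteq> {0}" "D \<subseteq> C" "finite B" "D \<subseteq> span B"
proof -
  have sub: "subspace C"
    using C(1) by (simp add: subcoalgebra_def)
  obtain c where c: "c \<in> C" "c \<noteq> 0"
    using C(2) subspace_0[OF sub] by blast
  obtain R B where R: "right_coideal R" "c \<in> R" "finite B" "R \<subseteq> span B"
      "\<forall>K. subcoalgebra K \<longrightarrow> c \<in> K \<longrightarrow> R \<subseteq> K"
    by (rule right_coideal_generated)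
  then have RC: "R \<subseteq> C"
    using C(1) c(1) by simp
  let ?S = "{rhit g r | g r. linear_functional scale g \<and> r \<in> R}"
  have "\<exists>F. finite F \<and> (\<forall>f. linear_functional scale f \<longrightarrow> rhit f b \<in> span F)" for b
    by (rule finite_span_rhit[of b]) blast
  then obtain F where "\<forall>b. finite (F b) \<and> (\<forall>f. linear_functional scale f \<longrightarrow> rhit f b \<in> span (F b))"
    by (rule choice[OF allI, THEN exE])
  then have F: "finite (F b)" "linear_functional scale f \<Longrightarrow> rhit f b \<in> span (F b)" for b f
    by auto
  \<comment> \<open>For each of the finitely many \<open>b\<close> in \<open>B\<close>, the vectors
    \<open>rhit f b\<close> stay in a span that does not depend on \<open>f\<close>; linearity
    extends this to all of \<open>R\<close>.\<close>
  have "rhit f r \<in> span (\<Union>(F ` B))" if "linear_functional scale f" "r \<in> R" for f r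
  proof -
    have "r \<in> span B" using R that by blast
    then show ?thesis
    proof (induction rule: span_induct_alt)
      case base
      show ?case by (simp add: linear_map_simps[OF linear_rhit[OF that(1)]] span_zero)
    next
      case (step c x y)
      have "rhit f x \<in> span (\<Union>(F ` B))"
        using F(2)[OF that(1), of x] span_mono[of "F x" "\<Union>(F ` B)"] step(1) by blast
      with step show ?case
        by (simp add: linear_map_simps[OF linear_rhit[OF that(1)]] span_add span_scale)
    qed
  qed
  then have "span ?S \<subseteq> span (\<Union>(F ` B))"
    by (intro span_minimal) auto
  moreover have "finite (\<Union>(F ` B))"
    using R(3) F(1) by blast
  moreover have "subcoalgebra (span ?S)"
  proof (rule subcoalgebra_span)
    fix f s assume f: "linear_functional scale f" and "s \<in> ?S"
    then obtain g r where g: "linear_functional scale g" "r \<in> R" "s = rhit g r" by blast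
    have "lhit f s = rhit g (lhit f r)"
      using lhit_rhit[OF g(1) f] g(3) by simp
    moreover have "lhit f r \<in> R"
      using R(1) f g(2) by (simp add: right_coideal_def)
    ultimately show "lhit f s \<in> span ?S"
      using g(1) by (intro span_base) blast
    have "rhit f s = rhit (\<lambda>x. g (lhit f x)) r"
      using rhit_rhit[OF g(1) f] g(3) by simp
    then show "rhit f s \<in> span ?S"
      using functional_lhit[OF g(1) f] g(2) by (intro span_base) blast
  qed
  moreover have "span ?S \<subseteq> C"
    using subcoalgebra_rhit[OF C(1)] RC sub by (intro span_minimal) auto
  moreover have "c \<in> span ?S"
    using rhit_counit[of c] linear_counit R(2) by (intro span_base) force
  ultimately show ?thesis
    using c(2) by (intro that[of "span ?S" "\<Union>(F ` B)"]) auto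
qed

text \<open>A nonzero subcoalgebra of least dimension is simple. Passing first to the
  finite-dimensional \<open>D\<close> makes a proper inclusion visible in
  \<open>dim\<close>.\<close>

lemma simple_subcoalgebra_in:
  assumes C: "subcoalgebra C" "C \<noteq> {0}"
  obtains B where "simple_subcoalgebra B" "B \<subseteq> C"
proof -
  obtain D F where D: "subcoalgebra D" "D \<noteq> {0}" "D \<subseteq> C" "finite F" "D \<subseteq> span F"
    by (rule subcoalgebra_generated_in[OF C])
  let ?P = "\<lambda>B. subcoalgebra B \<and> B \<noteq> {0} \<and> B \<subseteq> D"
  obtain B where B: "?P B" and least: "\<And>B'. ?P B' \<Longrightarrow> dim B \<le> dim B'"
    using ex_has_least_nat[of ?P D dim] D(1,2) by auto
  have "E = {0} \<or> E = B" if E: "subcoalgebra E" "E \<subseteq> B" for E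
  proof (rule ccontr)
    assume n: "\<not> (E = {0} \<or> E = B)"
    then have "dim E < dim B"
      using E B D(4,5) by (intro dim_less_of_psubset[of E B F]) (auto simp: subcoalgebra_def)
    moreover have "dim B \<le> dim E"
      using E B n by (intro least) auto
    ultimately show False by simp
  qed
  with B D(3) show ?thesis
    by (intro that[of B]) (auto simp: simple_subcoalgebra_def)
qed

section \<open>Grouplike elements and weight vectors\<close>

definition grouplike :: "'h \<Rightarrow> bool" where
  "grouplike g \<longleftrightarrow> \<Delta> g = pure_tensor scale scale g g \<and> \<epsilon> g = 1"

lemma lhit_grouplike:
  assumes "grouplike g" "linear_functional scale f"
  shows "lhit f g = scale (f g) g"
  using assms unfolding lhit_def contract_right_def grouplike_def
  by (simp add: tensor_lift_pure[OF bilinear_contract_right] vector_space_axioms)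

text \<open>If \<open>b\<close> spans \<open>B\<close>, then
  \<open>\<Delta> b = c (b \<otimes> b)\<close> for some scalar \<open>c\<close>. The counit law
  forces \<open>c * \<epsilon> b = 1\<close>, so the rescaled vector \<open>scale c b\<close> is
  grouplike.\<close>

lemma grouplike_in_simple:
  assumes B: "simple_subcoalgebra B" "dim B = 1"
  obtains g where "g \<in> B" "grouplike g"
proof -
  have sub: "subspace B" and \<Delta>: "\<And>b. b \<in> B \<Longrightarrow> \<Delta> b \<in> tensor_subspace scale scale B B"
    using B(1) by (auto simp: simple_subcoalgebra_def subcoalgebra_def)
  obtain b where b: "b \<in> B" "span {b} = B"
  proof -
    obtain A where A: "A \<subseteq> B" "independent A" "B \<subseteq> span A" "card A = dim B"
      using basis_exists by blast
    then obtain b where "A = {b}"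
      using B(2) card_1_singletonE by metis
    with A have "b \<in> B" "span {b} = B"
      using span_subspace[OF _ _ sub] by auto
    then show ?thesis by (rule that)
  qed
  note pure = bilinear_pure_tensor[OF vector_space_axioms vector_space_axioms]
  let ?p = "pure_tensor scale scale"
  have "tensor_subspace scale scale B B \<subseteq> range (\<lambda>c. fun_scale c (?p b b))"
  proof -
    have "?p x y \<in> range (\<lambda>c. fun_scale c (?p b b))" if xy: "x \<in> B" "y \<in> B" for x y
    proof -
      obtain c d where "x = scale c b" "y = scale d b"
        using xy unfolding b(2)[symmetric] span_singleton by blast
      then have "?p x y = fun_scale (c * d) (?p b b)"
        using linear_map_simps(3)[OF bilinear_mapD(4)[OF pure]]
          linear_map_simps(3)[OF bilinear_mapD(5)[OF pure]]
        by (simp add: fun_scale_def mult.assoc mult.left_commute)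
      then show ?thesis by blast
    qed
    then have "tensor_subspace scale scale B B \<subseteq> module.span fun_scale {?p b b}"
      unfolding tensor_subspace_def module.span_singleton[OF module_fun_scale]
      by (intro module.span_minimal[OF module_fun_scale])
        (auto simp flip: module.span_singleton[OF module_fun_scale]
          intro: module.subspace_span[OF module_fun_scale])
    then show ?thesis
      unfolding module.span_singleton[OF module_fun_scale] .
  qed
  with \<Delta>[OF b(1)] obtain c where c: "\<Delta> b = fun_scale c (?p b b)"
    by auto
  note bil = bilinear_contract_right[OF vector_space_axioms linear_counit]
  have "b = tensor_lift scale scale (\<lambda>x y. scale (\<epsilon> y) x) (\<Delta> b)"
    by (rule counit_right[symmetric])
  also have "\<dots> = scale (c * \<epsilon> b) b"
    unfolding c by (simp add: tensor_lift_scale[OF bil] pure_tensor_in tensor_lift_pure[OF bil])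
  finally have "scale (c * \<epsilon> b - 1) b = 0"
    by (simp add: scale_left_diff_distrib)
  moreover have "b \<noteq> 0"
    using b(2) B(1) by (auto simp: simple_subcoalgebra_def)
  ultimately have "c * \<epsilon> b = 1"
    by simp
  then have "\<epsilon> (scale c b) = 1"
    by (simp add: linear_map_simps(3)[OF linear_counit])
  moreover have "\<Delta> (scale c b) = ?p (scale c b) (scale c b)"
    by (simp only: linear_map_simps(3)[OF linear_comult] c
        linear_map_simps(3)[OF bilinear_mapD(4)[OF pure]]
        linear_map_simps(3)[OF bilinear_mapD(5)[OF pure]])
  moreover have "scale c b \<in> B"
    using b(1) subspace_scale[OF sub] by blast
  ultimately show ?thesis
    using that by (simp add: grouplike_def)
qed

text \<open>A simple subquotient comodule \<open>N/E\<close> of a pointed coalgebra is one-dimensional. The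
  coefficient space \<open>C\<close> of \<open>N/E\<close> is the sum of the images of \<open>N/E\<close> under the comodule
  maps \<open>rhit \<phi>\<close>, and contains a grouplike \<open>g\<close>. In a shortest expression of \<open>g\<close>
  through such images, the last summand comes from a vector of weight \<open>g\<close>.\<close>

lemma weight_vector_in_simple_subquotient:
  assumes K: "subcoalgebra K" "pointed K"
    and E: "right_coideal E" and N: "right_coideal N" and EN: "E \<subset> N" and NK: "N \<subseteq> K"
    and simple: "\<And>Q. right_coideal Q \<Longrightarrow> E \<subseteq> Q \<Longrightarrow> Q \<subseteq> N \<Longrightarrow> Q = E \<or> Q = N"
  obtains g n where "n \<in> N" "n \<notin> E" "g \<in> K" "grouplike g"
    "\<forall>f. linear_functional scale f \<longrightarrow> lhit f n - scale (f g) n \<in> E"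
proof -
  note subE = right_coidealD(1)[OF E] and subN = right_coidealD(1)[OF N]
  note stE = right_coidealD(2)[OF E] and stN = right_coidealD(2)[OF N]
  \<comment> \<open>These functionals play the part of the dual of the quotient by
    \<open>E\<close>.\<close>
  define A where "A = {\<phi>. linear_functional scale \<phi> \<and> (\<forall>e\<in>E. \<phi> e = 0)}"
  have A: "linear_functional scale \<phi>" "\<And>e. e \<in> E \<Longrightarrow> \<phi> e = 0" if "\<phi> \<in> A" for \<phi>
    using that by (auto simp: A_def)
  \<comment> \<open>Hence \<open>rhit \<phi>\<close> factors through \<open>N/E\<close>.\<close>
  have rhit_E: "rhit \<phi> e = 0" if "\<phi> \<in> A" "e \<in> E" for \<phi> e
  proof (rule linear_functionals_separate[OF vector_space_axioms])
    fix f assume f: "linear_functional scale f"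
    have "f (rhit \<phi> e) = \<phi> (lhit f e)"
      by (rule functional_hit_swap[OF f A(1)[OF that(1)]])
    then show "f (rhit \<phi> e) = f 0"
      using A(2)[OF that(1) stE[OF f that(2)]] by (simp add: linear_map_simps[OF f])
  qed
  define U where "U \<Phi> = (\<Union>\<phi>\<in>\<Phi>. rhit \<phi> ` N)" for \<Phi>
  have lhit_U: "lhit f s \<in> U \<Phi>" if f: "linear_functional scale f" and sub: "\<Phi> \<subseteq> A" and s: "s \<in> U \<Phi>" for f s \<Phi>
  proof -
    obtain \<phi> n where \<phi>: "\<phi> \<in> \<Phi>" "n \<in> N" "s = rhit \<phi> n"
      using s by (auto simp: U_def)
    then have "lhit f s = rhit \<phi> (lhit f n)"
      using lhit_rhit[OF A(1) f] sub by auto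
    then show ?thesis
      using \<phi> stN[OF f] by (auto simp: U_def)
  qed
  have co_U: "right_coideal (span (U \<Phi>))" if "\<Phi> \<subseteq> A" for \<Phi>
    using lhit_U[OF _ that] by (intro right_coideal_span span_base)
  have "subcoalgebra (span (U A))"
  proof (rule subcoalgebra_span)
    fix f s assume f: "linear_functional scale f" and s: "s \<in> U A"
    show "lhit f s \<in> span (U A)"
      using lhit_U[OF f order.refl s] by (rule span_base)
    obtain \<phi> n where \<phi>: "\<phi> \<in> A" "n \<in> N" "s = rhit \<phi> n"
      using s by (auto simp: U_def)
    have "rhit f s = rhit (\<lambda>x. \<phi> (lhit f x)) n"
      using rhit_rhit[OF A(1)[OF \<phi>(1)] f] \<phi>(3) by simp
    \<comment> \<open>Closure under \<open>rhit\<close> comes from \<open>A\<close> itself being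
      stable: \<open>lhit f\<close> maps \<open>E\<close> into \<open>E\<close>, so precomposing
      with it preserves vanishing on \<open>E\<close>.\<close>
    moreover have "(\<lambda>x. \<phi> (lhit f x)) \<in> A"
      using functional_lhit[OF A(1)[OF \<phi>(1)] f] A(2)[OF \<phi>(1)] stE[OF f] by (simp add: A_def)
    ultimately have "rhit f s \<in> U A"
      using \<phi>(2) unfolding U_def by blast
    then show "rhit f s \<in> span (U A)"
      by (rule span_base)
  qed
  moreover have "span (U A) \<noteq> {0}"
  proof -
    obtain n where n: "n \<in> N" "n \<notin> E"
      using EN by blast
    obtain \<phi> where \<phi>: "linear_functional scale \<phi>" "\<forall>e\<in>E. \<phi> e = 0" "\<phi> n = 1"
      by (rule functional_vanishing_on_subspace[OF vector_space_axioms subE n(2)])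
    \<comment> \<open>The counit recovers \<open>\<phi> n\<close> from the coefficient
      \<open>rhit \<phi> n\<close>, so a functional that detects \<open>n\<close> modulo
      \<open>E\<close> yields a nonzero coefficient.\<close>
    have "\<epsilon> (rhit \<phi> n) = 1"
      using counit_rhit[OF \<phi>(1)] \<phi>(3) by simp
    then have "rhit \<phi> n \<noteq> 0"
      using linear_map_simps(1)[OF linear_counit] by auto
    moreover have "\<phi> \<in> A"
      using \<phi> by (simp add: A_def)
    then have "rhit \<phi> n \<in> span (U A)"
      using n(1) by (intro span_base) (auto simp: U_def)
    ultimately show ?thesis by blast
  qed
  ultimately obtain B where B: "simple_subcoalgebra B" "B \<subseteq> span (U A)"
    by (rule simple_subcoalgebra_in)
  have "span (U A) \<subseteq> K"
    using K(1) NK A(1) subcoalgebra_rhit[OF K(1)]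
    by (intro span_minimal) (auto simp: U_def subcoalgebra_def)
  then have "B \<subseteq> K" using B(2) by blast
  then have "dim B = 1" using K(2) B(1) by (simp add: pointed_def)
  then obtain g where g: "g \<in> B" "grouplike g"
    by (rule grouplike_in_simple[OF B(1)])
  have gK: "g \<in> K" using g(1) \<open>B \<subseteq> K\<close> by blast
  have g0: "g \<noteq> 0"
    using g(2) linear_map_simps(1)[OF linear_counit] by (auto simp: grouplike_def)
  \<comment> \<open>A smallest set of images whose sum contains \<open>g\<close>. Minimality
    replaces a direct sum decomposition of the coefficient space.\<close>
  let ?P = "\<lambda>\<Phi>. finite \<Phi> \<and> \<Phi> \<subseteq> A \<and> g \<in> span (U \<Phi>)"
  have "\<exists>\<Phi>. ?P \<Phi>"
  proof -
    have "g \<in> span (U A)" using g(1) B(2) by blast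
    then obtain T r where T: "finite T" "T \<subseteq> U A" "g = (\<Sum>a\<in>T. scale (r a) a)"
      unfolding span_explicit by auto
    have "\<forall>t\<in>T. \<exists>\<phi>\<in>A. t \<in> rhit \<phi> ` N"
      using T(2) unfolding U_def by blast
    then obtain p where p: "\<forall>t\<in>T. p t \<in> A \<and> t \<in> rhit (p t) ` N"
      unfolding Bex_def by (rule bchoice[THEN exE])
    have "g \<in> span T"
      unfolding T(3) by (intro span_sum span_scale span_base)
    moreover have "T \<subseteq> U (p ` T)"
      using p by (auto simp: U_def)
    ultimately have "g \<in> span (U (p ` T))"
      using span_mono by blast
    then have "?P (p ` T)"
      using T(1) p by auto
    then show ?thesis ..
  qed
  then obtain \<Phi> where \<Phi>: "?P \<Phi>" and least: "\<And>\<Phi>'. ?P \<Phi>' \<Longrightarrow> card \<Phi> \<le> card \<Phi>'"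
    using ex_has_least_nat[of ?P _ card] by metis
  have "\<Phi> \<noteq> {}"
    using \<Phi> g0 by (auto simp: U_def)
  then obtain \<psi> where \<psi>: "\<psi> \<in> \<Phi>" by blast
  then have \<psi>A: "\<psi> \<in> A" using \<Phi> by blast
  note lin\<psi> = linear_map_simps[OF linear_rhit[OF A(1)[OF \<psi>A]]]
  \<comment> \<open>The sum of the other images. It misses \<open>g\<close>, because one functional
    fewer would otherwise suffice.\<close>
  define P where "P = span (U (\<Phi> - {\<psi>}))"
  have co_P: "right_coideal P"
    unfolding P_def using \<Phi> by (intro co_U) blast
  note subP = right_coidealD(1)[OF co_P] and stP = right_coidealD(2)[OF co_P]
  have gP: "g \<notin> P"
  proof
    assume "g \<in> P"
    then have "card \<Phi> \<le> card (\<Phi> - {\<psi>})"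
      using \<Phi> by (intro least) (auto simp: P_def)
    moreover have "card (\<Phi> - {\<psi>}) < card \<Phi>"
      using \<Phi> \<psi> by (intro psubset_card_mono) auto
    ultimately show False by simp
  qed
  obtain p n where n: "p \<in> P" "n \<in> N" "g = p + rhit \<psi> n"
  proof -
    let ?Z = "{p + rhit \<psi> n | p n. p \<in> P \<and> n \<in> N}"
    have "subspace ?Z"
    proof (rule subspaceI)
      show "0 \<in> ?Z"
        using subspace_0[OF subP] subspace_0[OF subN] lin\<psi>(1) by force
      show "x + y \<in> ?Z" if xy: "x \<in> ?Z" "y \<in> ?Z" for x y
      proof -
        obtain p n p' n' where "x = p + rhit \<psi> n" "y = p' + rhit \<psi> n'"
          "p \<in> P" "n \<in> N" "p' \<in> P" "n' \<in> N" using xy by blast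
        moreover from this have "x + y = (p + p') + rhit \<psi> (n + n')"
          by (simp add: lin\<psi> algebra_simps)
        ultimately show ?thesis
          using subspace_add[OF subP] subspace_add[OF subN] by blast
      qed
      show "scale c x \<in> ?Z" if x: "x \<in> ?Z" for c x
      proof -
        obtain p n where "x = p + rhit \<psi> n" "p \<in> P" "n \<in> N" using x by blast
        moreover from this have "scale c x = scale c p + rhit \<psi> (scale c n)"
          by (simp add: lin\<psi> algebra_simps)
        ultimately show ?thesis
          using subspace_scale[OF subP] subspace_scale[OF subN] by blast
      qed
    qed
    moreover have "U \<Phi> \<subseteq> ?Z"
    proof
      fix s assume "s \<in> U \<Phi>"
      then obtain \<phi> n where \<phi>: "\<phi> \<in> \<Phi>" "n \<in> N" "s = rhit \<phi> n"
        by (auto simp: U_def)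
      show "s \<in> ?Z"
      proof (cases "\<phi> = \<psi>")
        case True
        then have "s = 0 + rhit \<psi> n" using \<phi> by simp
        then show ?thesis using subspace_0[OF subP] \<phi>(2) by blast
      next
        case False
        then have "s \<in> P"
          unfolding P_def using \<phi> by (intro span_base) (auto simp: U_def)
        moreover have "s = s + rhit \<psi> 0" by (simp add: lin\<psi>)
        ultimately show ?thesis using subspace_0[OF subN] by blast
      qed
    qed
    ultimately have "span (U \<Phi>) \<subseteq> ?Z"
      by (intro span_minimal)
    then show ?thesis
      using \<Phi> that by blast
  qed
  \<comment> \<open>The kernel of the map from \<open>N\<close> to \<open>H/P\<close> induced by
    \<open>rhit \<psi>\<close>. It is a right coideal between \<open>E\<close> and \<open>N\<close>
    that omits \<open>n\<close>, so simplicity leaves only \<open>Q = E\<close>.\<close>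
  define Q where "Q = {x \<in> N. rhit \<psi> x \<in> P}"
  have "right_coideal Q"
    unfolding right_coideal_def
  proof (intro conjI allI impI)
    show "subspace Q"
      unfolding Q_def
      by (rule subspaceI)
        (auto simp: lin\<psi> subspace_0[OF subN] subspace_0[OF subP] subspace_add[OF subN]
          subspace_add[OF subP] subspace_scale[OF subN] subspace_scale[OF subP])
    fix f x assume f: "linear_functional scale f" and x: "x \<in> Q"
    have "rhit \<psi> (lhit f x) = lhit f (rhit \<psi> x)"
      by (rule lhit_rhit[OF A(1)[OF \<psi>A] f, symmetric])
    then show "lhit f x \<in> Q"
      using x stN[OF f] stP[OF f] by (simp add: Q_def)
  qed
  moreover have "E \<subseteq> Q"
    using EN rhit_E[OF \<psi>A] subspace_0[OF subP] by (auto simp: Q_def)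
  moreover have "Q \<subseteq> N" by (auto simp: Q_def)
  moreover have nQ: "n \<notin> Q"
  proof
    assume "n \<in> Q"
    then have "g \<in> P"
      using n subspace_add[OF subP] by (simp add: Q_def)
    with gP show False ..
  qed
  ultimately have QE: "Q = E"
    using simple[of Q] n(2) by blast
  have "lhit f n - scale (f g) n \<in> E" if f: "linear_functional scale f" for f
  proof -
    note linf = linear_map_simps[OF linear_lhit[OF f]]
    \<comment> \<open>Modulo \<open>P\<close> the vector \<open>rhit \<psi> n\<close> equals
      \<open>g\<close>, on which \<open>lhit f\<close> acts by the scalar \<open>f g\<close>.
      Injectivity of \<open>rhit \<psi>\<close> modulo \<open>E\<close> lifts this weight back to
      \<open>n\<close>.\<close>
    have "rhit \<psi> (lhit f n - scale (f g) n) = lhit f (rhit \<psi> n) - scale (f g) (rhit \<psi> n)"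
      by (simp add: lin\<psi> lhit_rhit[OF A(1)[OF \<psi>A] f])
    also have "\<dots> = lhit f (g - p) - scale (f g) (g - p)"
      using n(3) by simp
    also have "\<dots> = scale (f g) p - lhit f p"
      by (simp add: linf lhit_grouplike[OF g(2) f] scale_right_diff_distrib)
    also have "\<dots> \<in> P"
      using n(1) stP[OF f] by (intro subspace_diff[OF subP] subspace_scale[OF subP])
    finally have "lhit f n - scale (f g) n \<in> Q"
      using n(2) stN[OF f] subspace_diff[OF subN] subspace_scale[OF subN] by (simp add: Q_def)
    then show ?thesis by (simp add: QE)
  qed
  with n(2) nQ gK g(2) show ?thesis
    unfolding QE by (intro that) auto
qed

text \<open>Induction along a flag that is never built as a list. The hypothesis on \<open>n\<close>
  is the slicewise form of \<open>\<Delta> n \<in> n \<otimes> g + E \<otimes> H\<close>. Only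
  subspaces \<open>E\<close> already inside \<open>X\<close> have to be treated, so a largest right
  coideal inside \<open>X\<close> cannot stop short of the coideal generated by
  \<open>h\<close>.\<close>

theorem pointed_induct:
  assumes K: "subcoalgebra K" "pointed K" and X: "subspace X"
    and step: "\<And>E n g. subspace E \<Longrightarrow> E \<subseteq> X \<Longrightarrow> n \<in> K \<Longrightarrow> g \<in> K \<Longrightarrow> grouplike g \<Longrightarrow>
      (\<And>f. linear_functional scale f \<Longrightarrow> lhit f n - scale (f g) n \<in> E) \<Longrightarrow> n \<in> X"
  shows "K \<subseteq> X"
proof
  fix h assume h: "h \<in> K"
  obtain D B where D: "right_coideal D" "h \<in> D" "finite B" "D \<subseteq> span B"
      "\<forall>K. subcoalgebra K \<longrightarrow> h \<in> K \<longrightarrow> D \<subseteq> K"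
    by (rule right_coideal_generated)
  then have DK: "D \<subseteq> K"
    using K(1) h by simp
  have subD: "subspace D" using D(1) by (rule right_coidealD)
  \<comment> \<open>The right coideal \<open>{0}\<close> qualifies and dimensions are bounded by
    \<open>card B\<close>, so a largest candidate exists; \<open>Suc\<close> makes the bound
    strict.\<close>
  let ?P = "\<lambda>E. right_coideal E \<and> E \<subseteq> D \<and> E \<subseteq> X"
  have "?P {0}"
    using subspace_0[OF subD] subspace_0[OF X]
    by (auto simp: right_coideal_def subspace_single_0 linear_map_simps(1)[OF linear_lhit])
  moreover have "\<forall>E. ?P E \<longrightarrow> dim E < Suc (card B)"
    using D(3,4) by (auto simp: less_Suc_eq_le right_coideal_def intro!: dim_le_card_spanning)
  ultimately obtain E where E: "?P E" and greatest: "\<And>E'. ?P E' \<Longrightarrow> dim E' \<le> dim E"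
    using ex_has_greatest_nat[of ?P "{0}" dim "Suc (card B)"] by blast
  have subE: "subspace E" using E right_coidealD by blast
  have "E = D"
  proof (rule ccontr)
    assume "E \<noteq> D"
    let ?R = "\<lambda>N. right_coideal N \<and> E \<subset> N \<and> N \<subseteq> D"
    have "?R D" using \<open>E \<noteq> D\<close> E D(1) by blast
    \<comment> \<open>Least dimension above \<open>E\<close> makes \<open>N/E\<close> a simple
      comodule.\<close>
    then obtain N where N: "?R N" and least: "\<And>N'. ?R N' \<Longrightarrow> dim N \<le> dim N'"
      using ex_has_least_nat[of ?R D dim] by blast
    have simple: "Q = E \<or> Q = N" if Q: "right_coideal Q" "E \<subseteq> Q" "Q \<subseteq> N" for Q
    proof (rule ccontr)
      assume n: "\<not> (Q = E \<or> Q = N)"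
      then have "dim Q < dim N"
        using Q N D(3,4) by (intro dim_less_of_psubset[of Q N B]) (auto simp: right_coideal_def)
      moreover have "dim N \<le> dim Q"
        using Q N n by (intro least) auto
      ultimately show False by simp
    qed
    obtain g n where n: "n \<in> N" "n \<notin> E" "g \<in> K" "grouplike g"
      and w: "\<forall>f. linear_functional scale f \<longrightarrow> lhit f n - scale (f g) n \<in> E"
      by (rule weight_vector_in_simple_subquotient[OF K _ _ _ _ simple]) (use E N DK in auto)
    have nX: "n \<in> X"
      using E n(1) N DK w by (intro step[OF subE _ _ n(3,4)]) auto
    \<comment> \<open>Adjoining \<open>n\<close> gives a right coideal, because
      \<open>lhit f n\<close> is a multiple of \<open>n\<close> modulo \<open>E\<close>. It lies in
      \<open>X\<close> and contradicts the maximality of \<open>E\<close>.\<close>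
    let ?E' = "span (insert n E)"
    have sup: "E \<subseteq> ?E'" "n \<in> ?E'"
      using span_superset by blast+
    have "right_coideal ?E'"
    proof (rule right_coideal_span)
      fix f s assume f: "linear_functional scale f" and s: "s \<in> insert n E"
      show "lhit f s \<in> ?E'"
      proof (cases "s = n")
        case True
        have "lhit f n = (lhit f n - scale (f g) n) + scale (f g) n" by simp
        also have "\<dots> \<in> ?E'"
          using w f sup by (intro span_add span_scale) auto
        finally show ?thesis using True by simp
      next
        case False
        then show ?thesis
          using s E f sup by (auto simp: right_coideal_def)
      qed
    qed
    moreover have "?E' \<subseteq> D"
      using E N n(1) subD by (intro span_minimal) auto
    moreover have "?E' \<subseteq> X"
      using E nX X by (intro span_minimal) auto
    ultimately have "dim ?E' \<le> dim E"
      by (intro greatest) simp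
    moreover have "dim E < dim ?E'"
      using sup n(2) \<open>?E' \<subseteq> D\<close> D(3,4) subE
      by (intro dim_less_of_psubset[of E ?E' B]) (auto simp: subspace_span)
    ultimately show False by simp
  qed
  with E D(2) show "h \<in> X" by blast
qed

end

section \<open>Tensor products of modules\<close>

text \<open>\<open>finite_dimensional\<close> asks for a finite set whose span equals the range. The
  range is a subspace, so containment in a finite span suffices, and this is the form in which
  orbits are bounded below.\<close>

lemma finite_dimensional_range_iff:
  assumes "Vector_Spaces.linear s1 s2 \<phi>"
  shows "finite_dimensional s2 (range \<phi>) \<longleftrightarrow> (\<exists>B. finite B \<and> (\<forall>x. \<phi> x \<in> module.span s2 B))"
proof -
  interpret V: vector_space s2
    using assms by (simp add: linear_map_iff)
  have sub: "V.subspace (range \<phi>)"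
  proof (rule V.subspaceI)
    show "0 \<in> range \<phi>"
      using linear_map_simps(1)[OF assms] by (metis rangeI)
    show "x + y \<in> range \<phi>" if "x \<in> range \<phi>" "y \<in> range \<phi>" for x y
      using that by (auto simp flip: linear_map_simps(2)[OF assms])
    show "s2 c x \<in> range \<phi>" if "x \<in> range \<phi>" for c x
      using that by (auto simp flip: linear_map_simps(3)[OF assms])
  qed
  show ?thesis
  proof
    assume "finite_dimensional s2 (range \<phi>)"
    then show "\<exists>B. finite B \<and> (\<forall>x. \<phi> x \<in> V.span B)"
      unfolding finite_dimensional_def by auto
  next
    assume "\<exists>B. finite B \<and> (\<forall>x. \<phi> x \<in> V.span B)"
    then obtain B where "finite B" "range \<phi> \<subseteq> V.span B"
      by blast
    then show "finite_dimensional s2 (range \<phi>)"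
      using V.finite_dimensional_subspace[OF sub] by blast
  qed
qed

lemma tensor_lift_sum_list_in:
  assumes "bilinear_map sV sW sU f" "\<And>y. y \<in> set ys \<Longrightarrow> g y \<in> tensor_space sV sW"
  shows "tensor_lift sV sW f (\<Sum>y\<leftarrow>ys. g y) = (\<Sum>y\<leftarrow>ys. tensor_lift sV sW f (g y))"
proof -
  have "(\<Sum>y\<leftarrow>ys. g y) \<in> tensor_space sV sW \<and>
      tensor_lift sV sW f (\<Sum>y\<leftarrow>ys. g y) = (\<Sum>y\<leftarrow>ys. tensor_lift sV sW f (g y))"
    using assms(2)
  proof (induction ys)
    case Nil
    show ?case
      by (simp only: list.map sum_list.Nil tensor_subspace_ops(1) tensor_lift_zero[OF assms(1)] simp_thms)
  next
    case (Cons y ys)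
    then have IH: "(\<Sum>y\<leftarrow>ys. g y) \<in> tensor_space sV sW"
      "tensor_lift sV sW f (\<Sum>y\<leftarrow>ys. g y) = (\<Sum>y\<leftarrow>ys. tensor_lift sV sW f (g y))"
      "g y \<in> tensor_space sV sW"
      by auto
    show ?case
      by (simp only: list.map sum_list.Cons tensor_lift_add[OF assms(1) IH(3,1)] IH(2)
          tensor_subspace_ops(2)[OF IH(3,1)] simp_thms)
  qed
  then show ?thesis ..
qed

lemma tensor_subspace_span_finite:
  assumes vs: "vector_space sV" "vector_space sW"
  shows "tensor_subspace sV sW (module.span sV B) (module.span sW C) \<subseteq>
    module.span fun_scale ((\<lambda>(b, c). pure_tensor sV sW b c) ` (B \<times> C))" (is "_ \<subseteq> ?Z")
proof -
  interpret V: vector_space sV by fact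
  interpret W: vector_space sW by fact
  note pure = bilinear_pure_tensor[OF vs]
  note p1 = linear_map_simps[OF bilinear_mapD(4)[OF pure]]
  note p2 = linear_map_simps[OF bilinear_mapD(5)[OF pure]]
  note zero = module.span_zero[OF module_fun_scale] and add = module.span_add[OF module_fun_scale]
    and scale = module.span_scale[OF module_fun_scale] and base = module.span_base[OF module_fun_scale]
  have one: "pure_tensor sV sW b y \<in> ?Z" if b: "b \<in> B" and y: "y \<in> W.span C" for b y
    using y
  proof (induction rule: W.span_induct_alt)
    case base
    show ?case unfolding p2(1) by (rule zero)
  next
    case (step c x y)
    have "pure_tensor sV sW b x \<in> ?Z"
      using b step(1) by (intro base) auto
    then show ?case
      unfolding p2(2,3) by (intro add scale step(2))
  qed
  have "pure_tensor sV sW x y \<in> ?Z" if x: "x \<in> V.span B" and y: "y \<in> W.span C" for x y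
    using x
  proof (induction rule: V.span_induct_alt)
    case base
    show ?case unfolding p1(1) by (rule zero)
  next
    case (step c x z)
    show ?case
      unfolding p1(2,3) by (intro add scale step(2) one[OF step(1) y])
  qed
  then show ?thesis
    unfolding tensor_subspace_def
    by (intro module.span_minimal[OF module_fun_scale] module.subspace_span[OF module_fun_scale]) auto
qed

lemma finite_tensor_subspace:
  assumes vs: "vector_space sV" "vector_space sW" and M: "finite M" "M \<subseteq> tensor_space sV sW"
  obtains A B where "finite A" "finite B"
    "M \<subseteq> tensor_subspace sV sW (module.span sV A) (module.span sW B)"
proof -
  interpret V: vector_space sV by fact
  interpret W: vector_space sW by fact
  have "\<forall>m\<in>M. \<exists>xs. m = (\<Sum>(v, w)\<leftarrow>xs. pure_tensor sV sW v w)"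
    using M(2) tensor_space_iff[OF vs] by blast
  then obtain X where X: "\<forall>m\<in>M. m = (\<Sum>(v, w)\<leftarrow>X m. pure_tensor sV sW v w)"
    by (rule bchoice[THEN exE])
  let ?A = "\<Union>m\<in>M. fst ` set (X m)" and ?B = "\<Union>m\<in>M. snd ` set (X m)"
  have "m \<in> tensor_subspace sV sW (V.span ?A) (W.span ?B)" if m: "m \<in> M" for m
  proof -
    have "(\<Sum>(v, w)\<leftarrow>X m. pure_tensor sV sW v w) \<in> tensor_subspace sV sW (V.span ?A) (W.span ?B)"
    proof (rule module.sum_list_in_subspace[OF module_fun_scale subspace_tensor_subspace])
      fix x assume x: "x \<in> set (X m)"
      show "(case x of (v, w) \<Rightarrow> pure_tensor sV sW v w) \<in>
          tensor_subspace sV sW (V.span ?A) (W.span ?B)"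
        unfolding case_prod_unfold using x m
        by (intro pure_tensor_in V.span_base W.span_base) auto
    qed
    then show ?thesis
      using X m by simp
  qed
  moreover have "finite ?A" "finite ?B"
    using M(1) by auto
  ultimately show ?thesis
    by (intro that[of ?A ?B]) auto
qed

locale tensor_modules =
  hopf_algebra scale \<Delta> \<epsilon> S + V: left_module scale sV actV + W: left_module scale sW actW
  for scale :: "'k::field \<Rightarrow> 'h::ring_1 \<Rightarrow> 'h"
    and \<Delta> :: "'h \<Rightarrow> ('k, 'h, 'h) tensor"
    and \<epsilon> :: "'h \<Rightarrow> 'k"
    and S :: "'h \<Rightarrow> 'h"
    and sV :: "'k \<Rightarrow> 'v::ab_group_add \<Rightarrow> 'v"
    and actV :: "'h \<Rightarrow> 'v \<Rightarrow> 'v"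
    and sW :: "'k \<Rightarrow> 'w::ab_group_add \<Rightarrow> 'w"
    and actW :: "'h \<Rightarrow> 'w \<Rightarrow> 'w"
begin

section \<open>The diagonal action on the tensor product\<close>

lemmas vsV = V.V.vector_space_axioms and vsW = W.V.vector_space_axioms
lemmas vsH = vector_space_axioms
lemmas pure = bilinear_pure_tensor[OF V.V.vector_space_axioms W.V.vector_space_axioms]
lemmas linV = bilinear_mapD(5)[OF V.bilinear_act] and linW = bilinear_mapD(5)[OF W.bilinear_act]
lemmas linV_alg = bilinear_mapD(4)[OF V.bilinear_act] and linW_alg = bilinear_mapD(4)[OF W.bilinear_act]

abbreviation T :: "('k, 'v, 'w) tensor set" where "T \<equiv> tensor_space sV sW"

text \<open>The action of the algebra \<open>H \<otimes> H\<close>; the diagonal action is its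
  restriction along the comultiplication.\<close>

definition biact :: "'h \<Rightarrow> 'h \<Rightarrow> ('k, 'v, 'w) tensor \<Rightarrow> ('k, 'v, 'w) tensor" where
  "biact a b = tensor_lift sV sW (\<lambda>v w. pure_tensor sV sW (actV a v) (actW b w))"

abbreviation tact :: "'h \<Rightarrow> ('k, 'v, 'w) tensor \<Rightarrow> ('k, 'v, 'w) tensor" where
  "tact \<equiv> tensor_act scale \<Delta> sV actV sW actW"

lemma tact_eq: "tact h t = tensor_lift scale scale (\<lambda>a b. biact a b t) (\<Delta> h)"
  by (simp add: tensor_act_def biact_def)

lemma bilinear_pure_act: "bilinear_map sV sW fun_scale (\<lambda>v w. pure_tensor sV sW (actV a v) (actW b w))"
  unfolding bilinear_map_def
  using linear_functional_comp[OF linV bilinear_mapD(4)[OF pure]]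
    linear_functional_comp[OF linW bilinear_mapD(5)[OF pure]] by blast

lemma biact_sum_list:
  "biact a b (\<Sum>(v, w)\<leftarrow>xs. pure_tensor sV sW v w) =
    (\<Sum>(v, w)\<leftarrow>map (\<lambda>(v, w). (actV a v, actW b w)) xs. pure_tensor sV sW v w)"
  unfolding biact_def tensor_lift_sum_list[OF bilinear_pure_act]
  by (simp add: case_prod_unfold comp_def)

lemma T_sum_list:
  assumes "t \<in> T"
  obtains xs where "t = (\<Sum>(v, w)\<leftarrow>xs. pure_tensor sV sW v w)"
  using assms tensor_space_iff[OF vsV vsW] by blast

lemma biact_closed: "t \<in> T \<Longrightarrow> biact a b t \<in> T"
  unfolding biact_def
  by (rule tensor_lift_in_subspace[OF bilinear_pure_act subspace_tensor_subspace])
    (auto intro: pure_tensor_in)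

lemma bilinear_biact:
  assumes "t \<in> T"
  shows "bilinear_map scale scale fun_scale (\<lambda>a b. biact a b t)"
  unfolding bilinear_map_def biact_def
proof (intro conjI allI)
  show "Vector_Spaces.linear scale fun_scale
      (\<lambda>a. tensor_lift sV sW (\<lambda>v w. pure_tensor sV sW (actV a v) (actW b w)) t)" for b
    by (rule linear_tensor_lift_parameter[OF bilinear_pure_act _ assms])
      (rule linear_functional_comp[OF linV_alg bilinear_mapD(4)[OF pure]])
  show "Vector_Spaces.linear scale fun_scale
      (\<lambda>b. tensor_lift sV sW (\<lambda>v w. pure_tensor sV sW (actV a v) (actW b w)) t)" for a
    by (rule linear_tensor_lift_parameter[OF bilinear_pure_act _ assms])
      (rule linear_functional_comp[OF linW_alg bilinear_mapD(5)[OF pure]])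
qed

lemma biact_mult:
  assumes "t \<in> T"
  shows "biact a b (biact c d t) = biact (a * c) (b * d) t"
proof -
  obtain xs where xs: "t = (\<Sum>(v, w)\<leftarrow>xs. pure_tensor sV sW v w)"
    by (rule T_sum_list[OF assms])
  show ?thesis
    unfolding xs biact_sum_list
    by (simp add: case_prod_unfold comp_def V.act_mult W.act_mult)
qed

lemma biact_one:
  assumes "t \<in> T"
  shows "biact 1 1 t = t"
proof -
  obtain xs where xs: "t = (\<Sum>(v, w)\<leftarrow>xs. pure_tensor sV sW v w)"
    by (rule T_sum_list[OF assms])
  show ?thesis
    unfolding xs biact_sum_list by (simp add: case_prod_unfold comp_def V.act_one W.act_one)
qed

lemma tact_one: "t \<in> T \<Longrightarrow> tact 1 t = t"
  by (simp add: tact_eq comult_one tensor_lift_pure[OF bilinear_biact] biact_one)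

lemma tact_closed: "t \<in> T \<Longrightarrow> tact h t \<in> T"
  unfolding tact_eq
  by (rule tensor_lift_in_subspace[OF bilinear_biact subspace_tensor_subspace comult_closed])
    (auto intro: biact_closed)

lemma linear_tact:
  assumes "t \<in> T"
  shows "Vector_Spaces.linear scale fun_scale (\<lambda>h. tact h t)"
  unfolding tact_eq by (rule linear_lift_comult[OF bilinear_biact[OF assms]])

lemma tact_sum_list:
  assumes "\<Delta> h = (\<Sum>(a, b)\<leftarrow>xs. pure_tensor scale scale a b)" "t \<in> T"
  shows "tact h t = (\<Sum>(a, b)\<leftarrow>xs. biact a b t)"
  unfolding tact_eq assms(1) by (rule tensor_lift_sum_list[OF bilinear_biact[OF assms(2)]])

lemma bilinear_mult: "bilinear_map scale scale fun_scale (\<lambda>c d. pure_tensor scale scale (a * c) (b * d))"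
proof -
  note pureH = bilinear_pure_tensor[OF vsH vsH]
  have "Vector_Spaces.linear scale scale ((*) a)" for a
    by (simp add: linear_map_iff vsH mult_scale_right distrib_left)
  then show ?thesis
    unfolding bilinear_map_def
    using linear_functional_comp[OF _ bilinear_mapD(4)[OF pureH]]
      linear_functional_comp[OF _ bilinear_mapD(5)[OF pureH]] by blast
qed

lemma bilinear_mult': "bilinear_map scale scale fun_scale (\<lambda>a b. pure_tensor scale scale (a * c) (b * d))"
proof -
  note pureH = bilinear_pure_tensor[OF vsH vsH]
  have "Vector_Spaces.linear scale scale (\<lambda>a. a * c)" for c
    by (simp add: linear_map_iff vsH mult_scale_left distrib_right)
  then show ?thesis
    unfolding bilinear_map_def
    using linear_functional_comp[OF _ bilinear_mapD(4)[OF pureH]]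
      linear_functional_comp[OF _ bilinear_mapD(5)[OF pureH]] by blast
qed

text \<open>The comultiplication is multiplicative and \<open>biact\<close> respects products leg by
  leg; multiplying the Sweedler lists of \<open>h\<close> and \<open>k\<close> pairwise gives one
  for \<open>h * k\<close>.\<close>

lemma tact_mult:
  assumes t: "t \<in> T"
  shows "tact (h * k) t = tact h (tact k t)"
proof -
  obtain xs where xs: "\<Delta> h = (\<Sum>(a, b)\<leftarrow>xs. pure_tensor scale scale a b)"
    by (rule comult_sum_list)
  obtain ys where ys: "\<Delta> k = (\<Sum>(c, d)\<leftarrow>ys. pure_tensor scale scale c d)"
    by (rule comult_sum_list)
  have "bilinear_map scale scale fun_scale
      (\<lambda>a b. tensor_lift scale scale (\<lambda>c d. pure_tensor scale scale (a * c) (b * d)) (\<Delta> k))"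
    unfolding bilinear_map_def
    by (intro conjI allI linear_tensor_lift_parameter comult_closed bilinear_mult
        bilinear_mapD(4,5)[OF bilinear_mult'])
  then have "\<Delta> (h * k) = (\<Sum>(a, b)\<leftarrow>xs. \<Sum>(c, d)\<leftarrow>ys. pure_tensor scale scale (a * c) (b * d))"
    unfolding comult_mult tensor_mult_def xs
    by (simp only: tensor_lift_sum_list ys tensor_lift_sum_list[OF bilinear_mult])
  also have "\<dots> = (\<Sum>(a, b)\<leftarrow>concat (map (\<lambda>(a, b). map (\<lambda>(c, d). (a * c, b * d)) ys) xs).
      pure_tensor scale scale a b)"
    by (simp add: sum_list_concat map_concat comp_def case_prod_unfold)
  finally have "tact (h * k) t = (\<Sum>(a, b)\<leftarrow>concat (map (\<lambda>(a, b). map (\<lambda>(c, d). (a * c, b * d)) ys) xs).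
      biact a b t)"
    by (rule tact_sum_list[OF _ t])
  also have "\<dots> = (\<Sum>(a, b)\<leftarrow>xs. \<Sum>(c, d)\<leftarrow>ys. biact (a * c) (b * d) t)"
    by (simp add: sum_list_concat map_concat comp_def case_prod_unfold)
  also have "\<dots> = (\<Sum>(a, b)\<leftarrow>xs. \<Sum>(c, d)\<leftarrow>ys. biact a b (biact c d t))"
    by (simp only: biact_mult[OF t])
  also have "\<dots> = (\<Sum>(a, b)\<leftarrow>xs. biact a b (tact k t))"
  proof -
    have "biact a b (tact k t) = (\<Sum>(c, d)\<leftarrow>ys. biact a b (biact c d t))" for a b
      unfolding tact_sum_list[OF ys t] case_prod_unfold biact_def[of a b]
      by (rule tensor_lift_sum_list_in[OF bilinear_pure_act biact_closed[OF t]])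
    then show ?thesis by simp
  qed
  also have "\<dots> = tact h (tact k t)"
    by (rule tact_sum_list[OF xs tact_closed[OF t], symmetric])
  finally show ?thesis .
qed

section \<open>Slices of the diagonal action\<close>

lemma functional_actV: "linear_functional sV f \<Longrightarrow> linear_functional sV (\<lambda>v. f (actV a v))"
  by (rule linear_functional_comp[OF linV])

lemma functional_actW: "linear_functional sW f \<Longrightarrow> linear_functional sW (\<lambda>w. f (actW a w))"
  by (rule linear_functional_comp[OF linW])

text \<open>The action on the sliced leg is transposed onto the functional. This is what later
  allows an antipode to be inserted there.\<close>

lemma contract_right_biact:
  assumes "linear_functional sW f" "t \<in> T"
  shows "contract_right sV sW f (biact a b t) = actV a (contract_right sV sW (\<lambda>w. f (actW b w)) t)"
proof -
  obtain xs where xs: "t = (\<Sum>(v, w)\<leftarrow>xs. pure_tensor sV sW v w)"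
    by (rule T_sum_list[OF assms(2)])
  show ?thesis
    unfolding xs biact_sum_list contract_right_sum[OF vsV assms(1)]
      contract_right_sum[OF vsV functional_actW[OF assms(1)]]
    by (simp add: linear_map_sum_list[OF linV] linear_map_simps[OF linV] case_prod_unfold comp_def)
qed

lemma contract_left_biact:
  assumes "linear_functional sV f" "t \<in> T"
  shows "contract_left sV sW f (biact a b t) = actW b (contract_left sV sW (\<lambda>v. f (actV a v)) t)"
proof -
  obtain xs where xs: "t = (\<Sum>(v, w)\<leftarrow>xs. pure_tensor sV sW v w)"
    by (rule T_sum_list[OF assms(2)])
  show ?thesis
    unfolding xs biact_sum_list contract_left_sum[OF vsW assms(1)]
      contract_left_sum[OF vsW functional_actV[OF assms(1)]]
    by (simp add: linear_map_sum_list[OF linW] linear_map_simps[OF linW] case_prod_unfold comp_def)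
qed

lemma linear_contract_right_parameter:
  assumes "\<And>u. linear_functional sW (F u)" "\<And>w. linear_functional scale (\<lambda>u. F u w)" "t \<in> T"
  shows "Vector_Spaces.linear scale sV (\<lambda>u. contract_right sV sW (F u) t)"
  unfolding contract_right_def
proof (rule linear_tensor_lift_parameter[OF bilinear_contract_right[OF vsV assms(1)] _ assms(3)])
  fix v w
  show "Vector_Spaces.linear scale sV (\<lambda>u. sV (F u w) v)"
    using assms(2)[of w] by (simp add: linear_map_iff vsV V.V.scale_left_distrib)
qed

lemma linear_contract_left_parameter:
  assumes "\<And>u. linear_functional sV (F u)" "\<And>v. linear_functional scale (\<lambda>u. F u v)" "t \<in> T"
  shows "Vector_Spaces.linear scale sW (\<lambda>u. contract_left sV sW (F u) t)"
  unfolding contract_left_def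
proof (rule linear_tensor_lift_parameter[OF bilinear_contract_left[OF vsW assms(1)] _ assms(3)])
  fix v w
  show "Vector_Spaces.linear scale sW (\<lambda>u. sW (F u v) w)"
    using assms(2)[of v] by (simp add: linear_map_iff vsW W.V.scale_left_distrib)
qed

lemma bilinear_act_contract_right:
  assumes f: "linear_functional sW f" and t: "t \<in> T"
  shows "bilinear_map scale scale sV (\<lambda>a b. actV a (contract_right sV sW (\<lambda>w. f (actW b w)) t))"
  unfolding bilinear_map_def
proof (intro conjI allI)
  show "Vector_Spaces.linear scale sV (\<lambda>b. actV a (contract_right sV sW (\<lambda>w. f (actW b w)) t))" for a
    by (rule linear_functional_comp[OF linear_contract_right_parameter linV])
      (rule functional_actW[OF f] linear_functional_comp[OF linW_alg f] t)+
qed (rule linV_alg)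

lemma bilinear_act_contract_left:
  assumes f: "linear_functional sV f" and t: "t \<in> T"
  shows "bilinear_map scale scale sW (\<lambda>a b. actW b (contract_left sV sW (\<lambda>v. f (actV a v)) t))"
  unfolding bilinear_map_def
proof (intro conjI allI)
  show "Vector_Spaces.linear scale sW (\<lambda>a. actW b (contract_left sV sW (\<lambda>v. f (actV a v)) t))" for b
    by (rule linear_functional_comp[OF linear_contract_left_parameter linW])
      (rule functional_actV[OF f] linear_functional_comp[OF linV_alg f] t)+
qed (rule linW_alg)

lemma contract_right_tact:
  assumes f: "linear_functional sW f" and t: "t \<in> T"
  shows "contract_right sV sW f (tact h t) =
    tensor_lift scale scale (\<lambda>a b. actV a (contract_right sV sW (\<lambda>w. f (actW b w)) t)) (\<Delta> h)"
proof -
  obtain xs where xs: "\<Delta> h = (\<Sum>(a, b)\<leftarrow>xs. pure_tensor scale scale a b)"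
    by (rule comult_sum_list)
  have "contract_right sV sW f (tact h t) = (\<Sum>x\<leftarrow>xs. contract_right sV sW f (biact (fst x) (snd x) t))"
    unfolding tact_sum_list[OF xs t] case_prod_unfold contract_right_def
    by (rule tensor_lift_sum_list_in[OF bilinear_contract_right[OF vsV f] biact_closed[OF t]])
  then show ?thesis
    unfolding xs tensor_lift_sum_list[OF bilinear_act_contract_right[OF f t]]
    by (simp add: contract_right_biact[OF f t] case_prod_unfold)
qed

lemma contract_left_tact:
  assumes f: "linear_functional sV f" and t: "t \<in> T"
  shows "contract_left sV sW f (tact h t) =
    tensor_lift scale scale (\<lambda>a b. actW b (contract_left sV sW (\<lambda>v. f (actV a v)) t)) (\<Delta> h)"
proof -
  obtain xs where xs: "\<Delta> h = (\<Sum>(a, b)\<leftarrow>xs. pure_tensor scale scale a b)"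
    by (rule comult_sum_list)
  have "contract_left sV sW f (tact h t) = (\<Sum>x\<leftarrow>xs. contract_left sV sW f (biact (fst x) (snd x) t))"
    unfolding tact_sum_list[OF xs t] case_prod_unfold contract_left_def
    by (rule tensor_lift_sum_list_in[OF bilinear_contract_left[OF vsW f] biact_closed[OF t]])
  then show ?thesis
    unfolding xs tensor_lift_sum_list[OF bilinear_act_contract_left[OF f t]]
    by (simp add: contract_left_biact[OF f t] case_prod_unfold)
qed

text \<open>The smallest subspaces with \<open>H.t \<subseteq> right_support t \<otimes> W\<close> and
  \<open>H.t \<subseteq> V \<otimes> left_support t\<close>.\<close>

definition right_support :: "('k, 'v, 'w) tensor \<Rightarrow> 'v set" where
  "right_support t = V.V.span {contract_right sV sW f (tact h t) | f h. linear_functional sW f}"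

definition left_support :: "('k, 'v, 'w) tensor \<Rightarrow> 'w set" where
  "left_support t = W.V.span {contract_left sV sW f (tact h t) | f h. linear_functional sV f}"

lemma contract_right_in_support: "linear_functional sW f \<Longrightarrow> contract_right sV sW f (tact h t) \<in> right_support t"
  unfolding right_support_def by (rule V.V.span_base) blast

lemma contract_left_in_support: "linear_functional sV f \<Longrightarrow> contract_left sV sW f (tact h t) \<in> left_support t"
  unfolding left_support_def by (rule W.V.span_base) blast

lemma subspace_right_support: "V.V.subspace (right_support t)"
  unfolding right_support_def by (rule V.V.subspace_span)

lemma subspace_left_support: "W.V.subspace (left_support t)"
  unfolding left_support_def by (rule W.V.subspace_span)

section \<open>Stability of the supports\<close>

lemma antipode_grouplike: "grouplike g \<Longrightarrow> S g * g = 1"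
proof -
  assume g: "grouplike g"
  have "bilinear_map scale scale scale (\<lambda>a b. S a * b)"
    using linear_antipode vsH
    by (auto simp: bilinear_map_def linear_map_iff distrib_left distrib_right mult_scale_left mult_scale_right)
  from tensor_lift_pure[OF this] antipode_left[of g] g show ?thesis
    by (simp add: grouplike_def)
qed

lemma right_support_stable:
  assumes K: "subcoalgebra K" "pointed K" and t: "t \<in> T" and k: "k \<in> K" and v: "v \<in> right_support t"
  shows "actV k v \<in> right_support t"
proof -
  let ?V = "right_support t"
  let ?X = "{h. \<forall>v\<in>?V. actV h v \<in> ?V}"
  note subV = subspace_right_support[of t]
  have subX: "subspace ?X"
    by (rule subspaceI)
      (auto simp: linear_map_simps[OF linV_alg] V.V.subspace_0[OF subV] V.V.subspace_add[OF subV]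
        V.V.subspace_scale[OF subV])
  have "K \<subseteq> ?X"
  proof (rule pointed_induct[OF K subX])
    fix E n g
    assume E: "subspace E" "E \<subseteq> ?X" and g: "grouplike g"
      and w: "\<And>f. linear_functional scale f \<Longrightarrow> lhit f n - scale (f g) n \<in> E"
    \<comment> \<open>The hypothesis on \<open>n\<close> says that all right slices of this tensor
      lie in \<open>E\<close>, so it belongs to \<open>E \<otimes> H\<close>.\<close>
    let ?s = "\<Delta> n - pure_tensor scale scale n g"
    have gT: "pure_tensor scale scale n g \<in> tensor_space scale scale"
      by (simp add: pure_tensor_in)
    have sT: "?s \<in> tensor_space scale scale"
      by (rule tensor_subspace_ops(3)[OF comult_closed gT])
    have s: "?s \<in> tensor_subspace scale scale E UNIV"
    proof (rule tensor_in_if_contract_right_in[OF vsH vsH sT])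
      fix f assume f: "linear_functional scale f"
      show "contract_right scale scale f ?s \<in> E"
        using w[OF f] unfolding lhit_def contract_right_def
        by (simp add: tensor_lift_diff[OF bilinear_contract_right[OF vsH f] comult_closed gT]
            tensor_lift_pure[OF bilinear_contract_right[OF vsH f]])
    qed
    have gen: "actV n (contract_right sV sW f (tact h t)) \<in> ?V" if f: "linear_functional sW f" for f h
    proof -
      let ?m = "tact h t"
      \<comment> \<open>The twist by \<open>S g\<close> cancels the action of \<open>g\<close> on
        the right leg: in the term \<open>n \<otimes> g\<close> the functional becomes
        \<open>f\<close> again, since \<open>S g * g = 1\<close>.\<close>
      let ?f = "\<lambda>w. f (actW (S g) w)"
      let ?G = "\<lambda>a b. actV a (contract_right sV sW (\<lambda>w. ?f (actW b w)) ?m)"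
      have m: "?m \<in> T" by (rule tact_closed[OF t])
      have f': "linear_functional sW ?f" by (rule functional_actW[OF f])
      note G = bilinear_act_contract_right[OF f' m]
      have "tensor_lift scale scale ?G (\<Delta> n) = contract_right sV sW ?f (tact (n * h) t)"
        by (simp only: contract_right_tact[OF f' m] tact_mult[OF t])
      then have 1: "tensor_lift scale scale ?G (\<Delta> n) \<in> ?V"
        by (simp only: contract_right_in_support[OF f'])
      \<comment> \<open>The left legs of \<open>?s\<close> lie in \<open>E\<close> and hence
        preserve the support by the induction hypothesis, while the vectors they act on are slices
        of \<open>tact h t\<close>.\<close>
      have 2: "tensor_lift scale scale ?G ?s \<in> ?V"
        using E(2) contract_right_in_support[OF functional_actW[OF f']]
        by (intro tensor_lift_in_subspace[OF G subV s]) auto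
      have "tensor_lift scale scale ?G ?s = tensor_lift scale scale ?G (\<Delta> n) - ?G n g"
        by (simp only: tensor_lift_diff[OF G comult_closed gT] tensor_lift_pure[OF G])
      moreover have "?G n g = actV n (contract_right sV sW f ?m)"
        by (simp add: W.act_mult[symmetric] antipode_grouplike[OF g] W.act_one)
      ultimately have "actV n (contract_right sV sW f ?m) =
          tensor_lift scale scale ?G (\<Delta> n) - tensor_lift scale scale ?G ?s"
        by simp
      then show ?thesis
        using V.V.subspace_diff[OF subV 1 2] by simp
    qed
    have "actV n v \<in> ?V" if "v \<in> ?V" for v
      using that unfolding right_support_def[of t]
    proof (induction rule: V.V.span_induct_alt)
      case base
      show ?case
        by (simp add: linear_map_simps[OF linV] V.V.span_zero)
    next
      case (step c x y)
      then show ?case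
        using gen unfolding right_support_def
        by (auto simp: linear_map_simps[OF linV] intro!: V.V.span_add V.V.span_scale)
    qed
    then show "n \<in> ?X" by blast
  qed
  with k v show ?thesis by blast
qed

text \<open>Stability of the left support needs no pointedness, since
  \<open>1 \<otimes> h = \<Sum> (S h\<^sub>1 \<otimes> 1) \<Delta> h\<^sub>2\<close>; the analogous formula for \<open>h \<otimes> 1\<close> involves the
  inverse of the antipode.\<close>

lemma left_support_stable:
  assumes t: "t \<in> T" and w: "w \<in> left_support t"
  shows "actW h w \<in> left_support t"
proof -
  let ?W = "left_support t"
  note subW = subspace_left_support[of t]
  have mult: "Vector_Spaces.linear scale scale (\<lambda>a. S a * x)" "Vector_Spaces.linear scale scale (\<lambda>x. S a * x)"
    for a x
    using linear_antipode
    by (auto simp: linear_map_iff distrib_left distrib_right mult_scale_left mult_scale_right)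
  then have bilS: "bilinear_map scale scale scale (\<lambda>a b. S a * b)"
    by (simp add: bilinear_map_def)
  have gen: "actW h (contract_left sV sW f (tact k t)) \<in> ?W" if f: "linear_functional sV f" for f k
  proof -
    let ?m = "tact k t"
    have m: "?m \<in> T" by (rule tact_closed[OF t])
    \<comment> \<open>The slice of \<open>?m\<close> after \<open>z\<close> has acted on its left
      leg.\<close>
    let ?C = "\<lambda>z. contract_left sV sW (\<lambda>v. f (actV z v)) ?m"
    have C: "Vector_Spaces.linear scale sW ?C"
      by (rule linear_contract_left_parameter[OF functional_actV[OF f] linear_functional_comp[OF linV_alg f] m])
    \<comment> \<open>Summed over the threefold Sweedler components of \<open>h\<close>, this lets
      \<open>S h1 * h2\<close> act on the left leg and \<open>h3\<close> on the right leg. It is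
      evaluated in two groupings.\<close>
    let ?F = "\<lambda>a x y. actW y (?C (S a * x))"
    have F: "\<And>v w. Vector_Spaces.linear scale sW (\<lambda>u. ?F u v w)"
        "\<And>u w. Vector_Spaces.linear scale sW (\<lambda>v. ?F u v w)"
        "\<And>u v. Vector_Spaces.linear scale sW (\<lambda>w. ?F u v w)"
      using linear_functional_comp[OF mult(1) linear_functional_comp[OF C linW]]
        linear_functional_comp[OF mult(2) linear_functional_comp[OF C linW]] linW_alg by auto
    \<comment> \<open>Grouping the last two components gives slices of
      \<open>tact (b * k) t\<close>, which lie in the support by definition.\<close>
    have "tensor_lift scale scale (\<lambda>a b. tensor_lift scale scale (\<lambda>x y. ?F a x y) (\<Delta> b)) (\<Delta> h) \<in> ?W"
    proof (rule tensor_lift_in_subspace[OF bilinear_nested_right[OF F] subW comult_closed])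
      fix a b
      have "tensor_lift scale scale (\<lambda>x y. ?F a x y) (\<Delta> b) =
          contract_left sV sW (\<lambda>v. f (actV (S a) v)) (tact (b * k) t)"
        by (simp only: contract_left_tact[OF functional_actV[OF f] m] tact_mult[OF t] V.act_mult)
      then show "tensor_lift scale scale (\<lambda>x y. ?F a x y) (\<Delta> b) \<in> ?W"
        by (simp only: contract_left_in_support[OF functional_actV[OF f]])
    qed
    \<comment> \<open>Grouping the first two components instead lets the antipode law collapse
      \<open>S h1 * h2\<close> to the counit, and \<open>h\<close> is left acting on the right leg
      alone.\<close>
    also have "tensor_lift scale scale (\<lambda>a b. tensor_lift scale scale (\<lambda>x y. ?F a x y) (\<Delta> b)) (\<Delta> h) =
        tensor_lift scale scale (\<lambda>a b. tensor_lift scale scale (\<lambda>x y. ?F x y b) (\<Delta> a)) (\<Delta> h)"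
      by (rule coassoc_trilinear[OF F, symmetric])
    also have "\<dots> = tensor_lift scale scale (\<lambda>a b. actW (scale (\<epsilon> a) b) (?C 1)) (\<Delta> h)"
    proof -
      have "tensor_lift scale scale (\<lambda>x y. ?F x y b) (\<Delta> a) = actW (scale (\<epsilon> a) b) (?C 1)" for a b
      proof -
        have "tensor_lift scale scale (\<lambda>x y. ?F x y b) (\<Delta> a) =
            actW b (?C (tensor_lift scale scale (\<lambda>x y. S x * y) (\<Delta> a)))"
          by (rule tensor_lift_compose[OF bilS linear_functional_comp[OF C linW] comult_closed, symmetric])
        also have "\<dots> = actW b (?C (scale (\<epsilon> a) 1))"
          by (simp only: antipode_left)
        also have "\<dots> = actW (scale (\<epsilon> a) b) (?C 1)"
          unfolding linear_map_simps(3)[OF C]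
          by (simp only: linear_map_simps(3)[OF linW] linear_map_simps(3)[OF linW_alg])
        finally show ?thesis .
      qed
      then show ?thesis by simp
    qed
    also have "\<dots> = actW (tensor_lift scale scale (\<lambda>a b. scale (\<epsilon> a) b) (\<Delta> h)) (?C 1)"
      by (rule tensor_lift_compose[OF bilinear_contract_left[OF vsH linear_counit] linW_alg
            comult_closed, symmetric])
    also have "\<dots> = actW h (contract_left sV sW f ?m)"
      by (simp only: counit_left V.act_one)
    finally show ?thesis .
  qed
  show ?thesis
    using w unfolding left_support_def[of t]
  proof (induction rule: W.V.span_induct_alt)
    case base
    show ?case
      by (simp add: linear_map_simps[OF linW] W.V.span_zero)
  next
    case (step c x y)
    then show ?case
      using gen unfolding left_support_def
      by (auto simp: linear_map_simps[OF linW] intro!: W.V.span_add W.V.span_scale)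
  qed
qed

section \<open>Local finiteness of the supports and the two inclusions\<close>

lemma finite_supports:
  assumes t: "t \<in> T" and fin: "finite_dimensional fun_scale (range (\<lambda>h. tact h t))"
  obtains A B where "finite A" "finite B" "right_support t \<subseteq> V.V.span A" "left_support t \<subseteq> W.V.span B"
proof -
  obtain M where M: "finite M" "module.span fun_scale M = range (\<lambda>h. tact h t)"
    using fin unfolding finite_dimensional_def by blast
  have "M \<subseteq> range (\<lambda>h. tact h t)"
    unfolding M(2)[symmetric] by (rule module.span_superset[OF module_fun_scale])
  then have MT: "M \<subseteq> T"
    using tact_closed[OF t] by blast
  obtain A B where AB: "finite A" "finite B"
      "M \<subseteq> tensor_subspace sV sW (V.V.span A) (W.V.span B)"
    by (rule finite_tensor_subspace[OF vsV vsW M(1) MT])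
  have "module.span fun_scale M \<subseteq> tensor_subspace sV sW (V.V.span A) (W.V.span B)"
    by (rule module.span_minimal[OF module_fun_scale AB(3) subspace_tensor_subspace])
  then have h: "tact h t \<in> tensor_subspace sV sW (V.V.span A) (W.V.span B)" for h
    unfolding M(2) by blast
  have "right_support t \<subseteq> V.V.span A"
    unfolding right_support_def
    using contract_right_in[OF vsV _ V.V.subspace_span h] by (intro V.V.span_minimal) auto
  moreover have "left_support t \<subseteq> W.V.span B"
    unfolding left_support_def
    using contract_left_in[OF vsW _ W.V.subspace_span h] by (intro W.V.span_minimal) auto
  ultimately show ?thesis
    using that AB(1,2) by blast
qed

text \<open>Since \<open>tact 1 t = t\<close>, the slices of \<open>t\<close> itself are among the
  generators of both supports.\<close>

lemma in_tensor_of_supports: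
  assumes "t \<in> T"
  shows "t \<in> tensor_subspace sV sW (right_support t) (left_support t)"
  using contract_right_in_support[of _ 1 t] contract_left_in_support[of _ 1 t]
  unfolding tact_one[OF assms]
  by (intro tensor_in_if_contractions_in[OF vsV vsW assms subspace_right_support]) auto

lemma right_support_locally_finite:
  assumes "virtually_pointed" and t: "t \<in> T" and A: "finite A" "right_support t \<subseteq> V.V.span A"
  shows "right_support t \<subseteq> locally_finite_part sV UNIV actV"
proof
  fix v assume v: "v \<in> right_support t"
  obtain K F where K: "hopf_subalgebra K" "pointed K" "finite F"
      "\<forall>h. \<exists>k. (\<forall>x\<in>F. k x \<in> K) \<and> h = (\<Sum>x\<in>F. x * k x)"
    using assms(1) unfolding virtually_pointed_def fin_gen_right_module_over_def by blast
  have coK: "subcoalgebra K"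
    using K(1) by (simp add: hopf_subalgebra_def)
  let ?B = "\<Union>x\<in>F. actV x ` A"
  have act_in: "actV x u \<in> V.V.span ?B" if x: "x \<in> F" and u: "u \<in> V.V.span A" for x u
    using u
  proof (induction rule: V.V.span_induct_alt)
    case base
    show ?case by (simp add: linear_map_simps[OF linV] V.V.span_zero)
  next
    case (step c a y)
    have "actV x a \<in> V.V.span ?B"
      using step(1) x by (intro V.V.span_base) blast
    with step(2) show ?case
      by (simp add: linear_map_simps[OF linV] V.V.span_add V.V.span_scale)
  qed
  have "actV h v \<in> V.V.span ?B" for h
  proof -
    obtain k where k: "\<forall>x\<in>F. k x \<in> K" "h = (\<Sum>x\<in>F. x * k x)"
      using K(4) by blast
    \<comment> \<open>The coefficients \<open>k x\<close> move \<open>v\<close> only within the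
      support, hence within the span of \<open>A\<close>; the finitely many \<open>x\<close> in
      \<open>F\<close> then map this span into the span of \<open>?B\<close>.\<close>
    have "actV h v = (\<Sum>x\<in>F. actV x (actV (k x) v))"
      unfolding k(2) by (simp add: linear_map_simps(6)[OF linV_alg] V.act_mult)
    also have "\<dots> \<in> V.V.span ?B"
      using right_support_stable[OF coK K(2) t _ v] k(1) A(2)
      by (intro V.V.span_sum act_in) auto
    finally show ?thesis .
  qed
  moreover have "finite ?B"
    using K(3) A(1) by blast
  ultimately show "v \<in> locally_finite_part sV UNIV actV"
    unfolding locally_finite_part_def finite_dimensional_range_iff[OF linV_alg] by blast
qed

lemma left_support_locally_finite:
  assumes t: "t \<in> T" and B: "finite B" "left_support t \<subseteq> W.V.span B"
  shows "left_support t \<subseteq> locally_finite_part sW UNIV actW"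
  using left_support_stable[OF t] B
  unfolding locally_finite_part_def finite_dimensional_range_iff[OF linW_alg] by blast

lemma locally_finite_part_tact_iff:
  "t \<in> locally_finite_part fun_scale T tact \<longleftrightarrow>
    t \<in> T \<and> (\<exists>B. finite B \<and> (\<forall>h. tact h t \<in> module.span fun_scale B))"
  unfolding locally_finite_part_def using finite_dimensional_range_iff[OF linear_tact] by blast

lemma linear_tact_right:
  "t \<in> T \<Longrightarrow> t' \<in> T \<Longrightarrow> tact h (t + t') = tact h t + tact h t'"
  "t \<in> T \<Longrightarrow> tact h (fun_scale c t) = fun_scale c (tact h t)"
proof -
  obtain xs where xs: "\<Delta> h = (\<Sum>(a, b)\<leftarrow>xs. pure_tensor scale scale a b)"
    by (rule comult_sum_list)
  interpret F: vector_space "fun_scale :: 'k \<Rightarrow> ('k, 'v, 'w) tensor \<Rightarrow> _"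
    by (rule vector_space_fun_scale)
  have "(\<Sum>(a, b)\<leftarrow>ys. biact a b (t + t')) = (\<Sum>(a, b)\<leftarrow>ys. biact a b t) + (\<Sum>(a, b)\<leftarrow>ys. biact a b t')"
    if "t \<in> T" "t' \<in> T" for ys
    unfolding biact_def case_prod_unfold tensor_lift_add[OF bilinear_pure_act that]
    by (rule sum_list_addf)
  then show "tact h (t + t') = tact h t + tact h t'" if "t \<in> T" "t' \<in> T"
    using that by (simp only: tact_sum_list[OF xs] tensor_subspace_ops)
  have "(\<Sum>(a, b)\<leftarrow>ys. biact a b (fun_scale c t)) = fun_scale c (\<Sum>(a, b)\<leftarrow>ys. biact a b t)"
    if "t \<in> T" for ys
    unfolding biact_def case_prod_unfold tensor_lift_scale[OF bilinear_pure_act that]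
    by (rule linear_map_sum_list[OF F.linear_scale_self, symmetric])
  then show "tact h (fun_scale c t) = fun_scale c (tact h t)" if "t \<in> T"
    using that by (simp only: tact_sum_list[OF xs] tensor_subspace_ops)
qed

lemma subspace_locally_finite_part: "module.subspace fun_scale (locally_finite_part fun_scale T tact)"
proof (rule module.subspaceI[OF module_fun_scale])
  interpret F: vector_space "fun_scale :: 'k \<Rightarrow> ('k, 'v, 'w) tensor \<Rightarrow> _"
    by (rule vector_space_fun_scale)
  show "0 \<in> locally_finite_part fun_scale T tact"
  proof -
    have "tact h 0 = 0" for h
      using linear_tact_right(2)[OF tensor_subspace_ops(1), of h 0] by simp
    then show ?thesis
      unfolding locally_finite_part_tact_iff
      by (intro conjI tensor_subspace_ops(1) exI[of _ "{}"]) simp_all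
  qed
  show "x + y \<in> locally_finite_part fun_scale T tact"
    if xy: "x \<in> locally_finite_part fun_scale T tact" "y \<in> locally_finite_part fun_scale T tact" for x y
  proof -
    obtain B C where B: "finite B" "\<And>h. tact h x \<in> F.span B" and C: "finite C" "\<And>h. tact h y \<in> F.span C"
      and T: "x \<in> T" "y \<in> T"
      using xy unfolding locally_finite_part_tact_iff by blast
    have "tact h (x + y) \<in> F.span (B \<union> C)" for h
      unfolding linear_tact_right(1)[OF T] using B(2) C(2) F.span_mono[of B "B \<union> C"] F.span_mono[of C "B \<union> C"]
      by (intro F.span_add) blast+
    then show ?thesis
      unfolding locally_finite_part_tact_iff
      by (intro conjI tensor_subspace_ops(2) T exI[of _ "B \<union> C"]) (use B(1) C(1) in auto)
  qed
  show "fun_scale c x \<in> locally_finite_part fun_scale T tact"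
    if x: "x \<in> locally_finite_part fun_scale T tact" for c x
  proof -
    obtain B where B: "finite B" "\<And>h. tact h x \<in> F.span B" and T: "x \<in> T"
      using x unfolding locally_finite_part_tact_iff by blast
    have "tact h (fun_scale c x) \<in> F.span B" for h
      unfolding linear_tact_right(2)[OF T] by (rule F.span_scale[OF B(2)])
    then show ?thesis
      unfolding locally_finite_part_tact_iff
      by (intro conjI tensor_subspace_ops(4) T exI[of _ B]) (use B(1) in auto)
  qed
qed

text \<open>The orbit of the pure tensor stays in \<open>H.v \<otimes> H.w\<close>, which is
  contained in the span of finitely many pure tensors.\<close>

lemma pure_tensor_locally_finite:
  assumes v: "v \<in> locally_finite_part sV UNIV actV" and w: "w \<in> locally_finite_part sW UNIV actW"
  shows "pure_tensor sV sW v w \<in> locally_finite_part fun_scale T tact"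
proof -
  obtain B where B: "finite B" "\<And>h. actV h v \<in> V.V.span B"
    using v unfolding locally_finite_part_def finite_dimensional_range_iff[OF linV_alg] by blast
  obtain C where C: "finite C" "\<And>h. actW h w \<in> W.V.span C"
    using w unfolding locally_finite_part_def finite_dimensional_range_iff[OF linW_alg] by blast
  have p: "pure_tensor sV sW v w \<in> T"
    by (simp add: pure_tensor_in)
  have "tact h (pure_tensor sV sW v w) \<in> tensor_subspace sV sW (V.V.span B) (W.V.span C)" for h
    unfolding tact_eq
  proof (rule tensor_lift_in_subspace[OF bilinear_biact[OF p] subspace_tensor_subspace comult_closed])
    fix a b
    show "biact a b (pure_tensor sV sW v w) \<in> tensor_subspace sV sW (V.V.span B) (W.V.span C)"
      unfolding biact_def tensor_lift_pure[OF bilinear_pure_act] by (intro pure_tensor_in B(2) C(2))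
  qed
  then have "\<forall>h. tact h (pure_tensor sV sW v w) \<in>
      module.span fun_scale ((\<lambda>(b, c). pure_tensor sV sW b c) ` (B \<times> C))"
    using tensor_subspace_span_finite[OF vsV vsW] by blast
  moreover have "finite ((\<lambda>(b, c). pure_tensor sV sW b c) ` (B \<times> C))"
    using B(1) C(1) by blast
  ultimately show ?thesis
    unfolding locally_finite_part_tact_iff using p by blast
qed

theorem locally_finite_part_tensor:
  assumes "virtually_pointed"
  shows "locally_finite_part fun_scale T tact =
    tensor_subspace sV sW (locally_finite_part sV UNIV actV) (locally_finite_part sW UNIV actW)"
proof
  show "tensor_subspace sV sW (locally_finite_part sV UNIV actV) (locally_finite_part sW UNIV actW)
      \<subseteq> locally_finite_part fun_scale T tact"
    unfolding tensor_subspace_def[of _ _ "locally_finite_part sV UNIV actV"]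
    using pure_tensor_locally_finite
    by (intro module.span_minimal[OF module_fun_scale _ subspace_locally_finite_part]) blast
  show "locally_finite_part fun_scale T tact \<subseteq>
      tensor_subspace sV sW (locally_finite_part sV UNIV actV) (locally_finite_part sW UNIV actW)"
  proof
    fix t assume "t \<in> locally_finite_part fun_scale T tact"
    then have t: "t \<in> T" and fin: "finite_dimensional fun_scale (range (\<lambda>h. tact h t))"
      by (auto simp: locally_finite_part_def)
    obtain A B where "finite A" "finite B" "right_support t \<subseteq> V.V.span A" "left_support t \<subseteq> W.V.span B"
      by (rule finite_supports[OF t fin])
    then have "right_support t \<subseteq> locally_finite_part sV UNIV actV"
      "left_support t \<subseteq> locally_finite_part sW UNIV actW"
      using right_support_locally_finite[OF assms t] left_support_locally_finite[OF t] by blast+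
    from tensor_subspace_mono[OF this] in_tensor_of_supports[OF t]
    show "t \<in> tensor_subspace sV sW (locally_finite_part sV UNIV actV) (locally_finite_part sW UNIV actW)"
      by blast
  qed
qed

end

theorem theorem2:
  fixes scale :: "'k::field \<Rightarrow> 'h::ring_1 \<Rightarrow> 'h"
    and \<Delta> :: "'h \<Rightarrow> ('k, 'h, 'h) tensor"
    and \<epsilon> :: "'h \<Rightarrow> 'k"
    and S :: "'h \<Rightarrow> 'h"
    and sV :: "'k \<Rightarrow> 'v::ab_group_add \<Rightarrow> 'v"
    and actV :: "'h \<Rightarrow> 'v \<Rightarrow> 'v"
    and sW :: "'k \<Rightarrow> 'w::ab_group_add \<Rightarrow> 'w"
    and actW :: "'h \<Rightarrow> 'w \<Rightarrow> 'w"
  assumes "hopf_algebra scale \<Delta> \<epsilon> S"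
    and "hopf_algebra.virtually_pointed scale \<Delta> S"
    and "left_module scale sV actV"
    and "left_module scale sW actW"
  shows "locally_finite_part fun_scale (tensor_space sV sW) (tensor_act scale \<Delta> sV actV sW actW) =
    tensor_subspace sV sW (locally_finite_part sV UNIV actV) (locally_finite_part sW UNIV actW)"
  using tensor_modules.locally_finite_part_tensor[OF tensor_modules.intro[OF assms(1,3,4)] assms(2)] .

end
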